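(* Let $X$ be a locally compact $\sigma$-compact Hausdorff space and let $G$ be a group of homeomorphisms of $X$ such that the orbit space $G\backslash X$ is a regular space. Then $G$ is properly isometrizable if and only if $G$ is equiregular and nearly proper.
   Context: Let $X$ be a topological space and $G$ a group of homeomorphisms of $X$. $G\backslash X$ denotes the orbit space with the quotient topology. Locally compact: every point has an open neighborhood whose closure is compact. $\sigma$-compact: a countable union of compact subsets. Regular means: for every point $x$ and every open neighborhood $U$ of $x$ there is an open neighborhood $V$ of $x$ with $\mathrm{cl}(V)\subset U$ (no further separation axiom is included). A gauge on $X$ is a function $\rho: X\times X\to[0,\infty)$ such that for all $x,y,z\in X$: (1) $\rho(x,x)=0$; (2) $\rho(x,y)=\rho(y,x)$; (3) $\rho(x,z)\le\rho(x,y)+\rho(y,z)$; (4) $\mathcal{N}_\rho(x,\epsilon)=\{y\in X:\rho(x,y)<\epsilon\}$ is an open subset of $X$ for all $x\in X$, $\epsilon\in(0,\infty)$. A gauge $\rho$ is proper if $\mathrm{cl}(\mathcal{N}_\rho(x,\epsilon))$ is compact for all $x\in X$, $\epsilon\in(0,\infty)$. For a collection $\mathcal{P}$ of gauges on $X$, the topology determined by $\mathcal{P}$ is the topology on the set $X$ with subbasis $\{\mathcal{N}_\rho(x,\epsilon):\rho\in\mathcal{P},x\in X,\epsilon\in(0,\infty)\}$. $\mathcal{P}$ is separating if for all distinct $x,y\in X$ there is $\rho\in\mathcal{P}$ with $\rho(x,y)>0$. $\mathcal{P}$ is a gauge structure on $X$ if it is separating and determines the given topology of $X$; it is a proper gauge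 structure if moreover every element of $\mathcal{P}$ is proper. $\mathcal{P}$ is $G$-invariant if $\rho(g(x),g(y))=\rho(x,y)$ for all $x,y\in X$, $g\in G$, $\rho\in\mathcal{P}$. $G$ is properly isometrizable if $X$ has a $G$-invariant proper gauge structure. $G$ is equiregular if for every $x\in X$ and every open neighborhood $U$ of $x$ in $X$ there is an open neighborhood $V$ of $x$ in $X$ such that $\mathrm{cl}(V)\subset U$ and every $y\in X$ has an open neighborhood $N_y$ with the property that for every $g\in G$, if $g(N_y)\cap\mathrm{cl}(V)\ne\emptyset$, then $g(N_y)\subset U$. $G$ is nearly proper if for all compact subsets $A$ and $B$ of $X$, $\mathrm{cl}\big(\bigcup\{g(A):g\in G\text{ and }g(A)\cap B\neq\emptyset\}\big)$ is compact. *)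

theory Defs
  imports "HOL-Analysis.Analysis" "HOL-Algebra.Bij"
begin

definition sigma_compact_space :: "'a topology \<Rightarrow> bool" where
  "sigma_compact_space X \<longleftrightarrow>
     (\<exists>\<K>. countable \<K> \<and> (\<forall>K\<in>\<K>. compactin X K) \<and> \<Union>\<K> = topspace X)"


section \<open>Groups of homeomorphisms and their orbit spaces\<close>

text \<open>
  Elements of \<^const>\<open>BijGroup\<close> are extensional, so two members of \<open>G\<close> are equal as soon as
  they agree on \<open>topspace X\<close>; the group operation is composition of maps.
\<close>

definition homeomorphism_group :: "'a topology \<Rightarrow> ('a \<Rightarrow> 'a) set \<Rightarrow> bool" where
  "homeomorphism_group X G \<longleftrightarrow>
     subgroup G (BijGroup (topspace X)) \<and> (\<forall>g\<in>G. homeomorphic_map X X g)"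

definition orbit_of :: "('a \<Rightarrow> 'a) set \<Rightarrow> 'a \<Rightarrow> 'a set" where
  "orbit_of G x = {g x | g. g \<in> G}"

definition orbit_space :: "'a topology \<Rightarrow> ('a \<Rightarrow> 'a) set \<Rightarrow> 'a set topology" where
  "orbit_space X G =
     topology (\<lambda>\<U>. \<U> \<subseteq> orbit_of G ` topspace X \<and>
                    openin X {x \<in> topspace X. orbit_of G x \<in> \<U>})"

lemma openin_orbit_space:
  "openin (orbit_space X G) \<U> \<longleftrightarrow>
     \<U> \<subseteq> orbit_of G ` topspace X \<and> openin X {x \<in> topspace X. orbit_of G x \<in> \<U>}"
proof -
  have "istopology (\<lambda>\<U>. \<U> \<subseteq> orbit_of G ` topspace X \<and>
                         openin X {x \<in> topspace X. orbit_of G x \<in> \<U>})"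
    unfolding istopology_def
  proof (intro conjI allI impI)
    fix S T
    assume S: "S \<subseteq> orbit_of G ` topspace X \<and> openin X {x \<in> topspace X. orbit_of G x \<in> S}"
      and T: "T \<subseteq> orbit_of G ` topspace X \<and> openin X {x \<in> topspace X. orbit_of G x \<in> T}"
    show "S \<inter> T \<subseteq> orbit_of G ` topspace X"
      using S by blast
    have "{x \<in> topspace X. orbit_of G x \<in> S \<inter> T} =
          {x \<in> topspace X. orbit_of G x \<in> S} \<inter> {x \<in> topspace X. orbit_of G x \<in> T}"
      by blast
    then show "openin X {x \<in> topspace X. orbit_of G x \<in> S \<inter> T}"
      using S T by (simp add: openin_Int)
  next
    fix \<K>
    assume K: "\<forall>K\<in>\<K>. K \<subseteq> orbit_of G ` topspace X \<and>
                      openin X {x \<in> topspace X. orbit_of G x \<in> K}"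
    then show "\<Union>\<K> \<subseteq> orbit_of G ` topspace X"
      by blast
    have "{x \<in> topspace X. orbit_of G x \<in> \<Union>\<K>} =
          (\<Union>K\<in>\<K>. {x \<in> topspace X. orbit_of G x \<in> K})"
      by blast
    moreover have "openin X (\<Union>K\<in>\<K>. {x \<in> topspace X. orbit_of G x \<in> K})"
      using K by (intro openin_Union) auto
    ultimately show "openin X {x \<in> topspace X. orbit_of G x \<in> \<Union>\<K>}"
      by simp
  qed
  then show ?thesis
    by (simp add: orbit_space_def topology_inverse')
qed

lemma topspace_orbit_space: "topspace (orbit_space X G) = orbit_of G ` topspace X"
proof
  show "topspace (orbit_space X G) \<subseteq> orbit_of G ` topspace X"
    using openin_orbit_space[of X G "topspace (orbit_space X G)"] by simp
  have "{x \<in> topspace X. orbit_of G x \<in> orbit_of G ` topspace X} = topspace X"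
    by blast
  then have "openin (orbit_space X G) (orbit_of G ` topspace X)"
    by (simp add: openin_orbit_space)
  then show "orbit_of G ` topspace X \<subseteq> topspace (orbit_space X G)"
    by (rule openin_subset)
qed

lemma quotient_map_orbit_of: "quotient_map X (orbit_space X G) (orbit_of G)"
  by (auto simp: quotient_map_def topspace_orbit_space openin_orbit_space)

lemma regular_space_iff_closure_of:
  "regular_space X \<longleftrightarrow>
     (\<forall>x U. openin X U \<and> x \<in> U \<longrightarrow> (\<exists>V. openin X V \<and> x \<in> V \<and> X closure_of V \<subseteq> U))"
  (is "_ \<longleftrightarrow> ?R")
proof
  assume "regular_space X"
  then show ?R
    unfolding neighbourhood_base_of_closedin[symmetric] neighbourhood_base_of
    by (meson closure_of_minimal order_trans)
next
  assume R: ?R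
  show "regular_space X"
    unfolding neighbourhood_base_of_closedin[symmetric] neighbourhood_base_of
  proof clarify
    fix W x
    assume "openin X W" "x \<in> W"
    then obtain V where "openin X V" "x \<in> V" "X closure_of V \<subseteq> W"
      using R by blast
    then show "\<exists>U V. openin X U \<and> closedin X V \<and> x \<in> U \<and> U \<subseteq> V \<and> V \<subseteq> W"
      by (meson closedin_closure_of closure_of_subset openin_subset)
  qed
qed


section \<open>Gauges\<close>

text \<open>
  Values of a gauge outside \<open>topspace X\<close> are irrelevant. The name \<open>gauge\<close> is taken by the
  unrelated notion from Henstock--Kurzweil integration.
\<close>

definition gauge_ball :: "'a topology \<Rightarrow> ('a \<Rightarrow> 'a \<Rightarrow> real) \<Rightarrow> 'a \<Rightarrow> real \<Rightarrow> 'a set" where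
  "gauge_ball X \<rho> x \<epsilon> = {y \<in> topspace X. \<rho> x y < \<epsilon>}"

definition gauge_on :: "'a topology \<Rightarrow> ('a \<Rightarrow> 'a \<Rightarrow> real) \<Rightarrow> bool" where
  "gauge_on X \<rho> \<longleftrightarrow>
     (\<forall>x\<in>topspace X. \<forall>y\<in>topspace X. 0 \<le> \<rho> x y) \<and>
     (\<forall>x\<in>topspace X. \<rho> x x = 0) \<and>
     (\<forall>x\<in>topspace X. \<forall>y\<in>topspace X. \<rho> x y = \<rho> y x) \<and>
     (\<forall>x\<in>topspace X. \<forall>y\<in>topspace X. \<forall>z\<in>topspace X. \<rho> x z \<le> \<rho> x y + \<rho> y z) \<and>
     (\<forall>x\<in>topspace X. \<forall>\<epsilon>>0. openin X (gauge_ball X \<rho> x \<epsilon>))"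

definition proper_gauge_on :: "'a topology \<Rightarrow> ('a \<Rightarrow> 'a \<Rightarrow> real) \<Rightarrow> bool" where
  "proper_gauge_on X \<rho> \<longleftrightarrow>
     gauge_on X \<rho> \<and>
     (\<forall>x\<in>topspace X. \<forall>\<epsilon>>0. compactin X (X closure_of gauge_ball X \<rho> x \<epsilon>))"

text \<open>
  \<open>relative_to topspace X\<close> makes the empty intersection equal to \<open>topspace X\<close>, so that the
  result is a topology on all of \<open>topspace X\<close> even if \<open>\<P>\<close> is empty.
\<close>

definition gauge_topology :: "'a topology \<Rightarrow> ('a \<Rightarrow> 'a \<Rightarrow> real) set \<Rightarrow> 'a topology" where
  "gauge_topology X \<P> =
     topology (arbitrary union_of
       (finite intersection_of
          (\<lambda>S. \<exists>\<rho>\<in>\<P>. \<exists>x\<in>topspace X. \<exists>\<epsilon>>0. S = gauge_ball X \<rho> x \<epsilon>)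
        relative_to topspace X))"

definition separating_gauges :: "'a topology \<Rightarrow> ('a \<Rightarrow> 'a \<Rightarrow> real) set \<Rightarrow> bool" where
  "separating_gauges X \<P> \<longleftrightarrow>
     (\<forall>x\<in>topspace X. \<forall>y\<in>topspace X. x \<noteq> y \<longrightarrow> (\<exists>\<rho>\<in>\<P>. \<rho> x y > 0))"

definition gauge_structure :: "'a topology \<Rightarrow> ('a \<Rightarrow> 'a \<Rightarrow> real) set \<Rightarrow> bool" where
  "gauge_structure X \<P> \<longleftrightarrow>
     (\<forall>\<rho>\<in>\<P>. gauge_on X \<rho>) \<and> separating_gauges X \<P> \<and> gauge_topology X \<P> = X"

definition proper_gauge_structure :: "'a topology \<Rightarrow> ('a \<Rightarrow> 'a \<Rightarrow> real) set \<Rightarrow> bool" where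
  "proper_gauge_structure X \<P> \<longleftrightarrow>
     gauge_structure X \<P> \<and> (\<forall>\<rho>\<in>\<P>. proper_gauge_on X \<rho>)"

definition invariant_gauges ::
    "'a topology \<Rightarrow> ('a \<Rightarrow> 'a) set \<Rightarrow> ('a \<Rightarrow> 'a \<Rightarrow> real) set \<Rightarrow> bool" where
  "invariant_gauges X G \<P> \<longleftrightarrow>
     (\<forall>\<rho>\<in>\<P>. \<forall>g\<in>G. \<forall>x\<in>topspace X. \<forall>y\<in>topspace X. \<rho> (g x) (g y) = \<rho> x y)"

definition properly_isometrizable :: "'a topology \<Rightarrow> ('a \<Rightarrow> 'a) set \<Rightarrow> bool" where
  "properly_isometrizable X G \<longleftrightarrow>
     (\<exists>\<P>. proper_gauge_structure X \<P> \<and> invariant_gauges X G \<P>)"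


section \<open>Conditions on the action\<close>

definition equiregular :: "'a topology \<Rightarrow> ('a \<Rightarrow> 'a) set \<Rightarrow> bool" where
  "equiregular X G \<longleftrightarrow>
     (\<forall>x\<in>topspace X. \<forall>U. openin X U \<and> x \<in> U \<longrightarrow>
        (\<exists>V. openin X V \<and> x \<in> V \<and> X closure_of V \<subseteq> U \<and>
             (\<forall>y\<in>topspace X. \<exists>N. openin X N \<and> y \<in> N \<and>
                (\<forall>g\<in>G. g ` N \<inter> X closure_of V \<noteq> {} \<longrightarrow> g ` N \<subseteq> U))))"

definition nearly_proper :: "'a topology \<Rightarrow> ('a \<Rightarrow> 'a) set \<Rightarrow> bool" where
  "nearly_proper X G \<longleftrightarrow>
     (\<forall>A B. compactin X A \<and> compactin X B \<longrightarrow>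
        compactin X (X closure_of (\<Union>{g ` A | g. g \<in> G \<and> g ` A \<inter> B \<noteq> {}})))"

end

theory Submission
  imports Defs
begin

text \<open>
  Call a symmetric \<open>G\<close>-invariant relation on \<open>X\<close> an entourage if every point \<open>x\<close> has a
  neighbourhood \<open>N\<close> with \<open>N \<times> N\<close> contained in it. Equiregularity gives, for \<open>x \<in> U\<close>, an entourage
  that stays inside \<open>U\<close> near \<open>x\<close>. The orbit space is regular and Lindelof, hence admits locally
  finite refinements of open covers; gluing entourages along such a refinement shows that
  every entourage \<open>E\<close> has an entourage \<open>D\<close> with \<open>D O D O D \<subseteq> E\<close>. In the other direction, near
  properness says that the relations \<open>\<Union>g. g K \<times> g K\<close> with \<open>K\<close> compact map compact sets into
  compact sets, so an entourage with that property can be enlarged step by step until all of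
  \<open>X \<times> X\<close> is exhausted. The resulting two-sided sequence with \<open>F k O F k O F k \<subseteq> F (k + 1)\<close> gives an
  invariant proper gauge by the chain construction of the metrization theorem for uniform
  spaces, with \<open>F k\<close> playing the role of the pairs at distance about \<open>2\<^sup>k\<close>.
\<close>

section \<open>Chain pseudometrics\<close>

text \<open>The length is an index because the comparison of \<open>f\<close> with chain sums is an
  induction on it. The sum is an argument so that chains can be cut and joined without naming their
  points.\<close>

inductive chain_sum :: "('a \<Rightarrow> 'a \<Rightarrow> real) \<Rightarrow> 'a set \<Rightarrow> nat \<Rightarrow> 'a \<Rightarrow> 'a \<Rightarrow> real \<Rightarrow> bool"
  for f S where
  refl: "x \<in> S \<Longrightarrow> chain_sum f S 0 x x 0"
| step: "chain_sum f S n x y r \<Longrightarrow> z \<in> S \<Longrightarrow> chain_sum f S (Suc n) x z (r + f y z)"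

lemma chain_sum_in:
  assumes "chain_sum f S n x y r"
  shows "x \<in> S" "y \<in> S"
  using assms by (induction; simp)+

lemma chain_sum_single:
  assumes "x \<in> S" "y \<in> S"
  shows "chain_sum f S (Suc 0) x y (f x y)"
  using step[OF refl[OF assms(1)] assms(2), of f] by simp

lemma chain_sum_trans:
  assumes "chain_sum f S m y z s" "chain_sum f S n x y r"
  shows "chain_sum f S (n + m) x z (r + s)"
  using assms
proof induction
  case (step m y z s w)
  then show ?case
    using chain_sum.step[of f S "n + m" x z "r + s" w] by (simp add: add.assoc)
qed simp

lemma chain_sum_sym:
  assumes "chain_sum f S n x y r" "\<And>x y. x \<in> S \<Longrightarrow> y \<in> S \<Longrightarrow> f x y = f y x"
  shows "chain_sum f S n y x r"
  using assms(1)
proof induction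
  case (step n x y r z)
  have "chain_sum f S (Suc 0) z y (f y z)"
    using chain_sum_single[of z S y f] chain_sum_in[OF step.hyps(1)] step.hyps(2) assms(2)[of y z]
    by simp
  from chain_sum_trans[OF step.IH this] show ?case
    by (simp add: add.commute)
qed (rule chain_sum.refl)

lemma chain_sum_nonneg:
  assumes "chain_sum f S n x y r" "\<And>x y. x \<in> S \<Longrightarrow> y \<in> S \<Longrightarrow> 0 \<le> f x y"
  shows "0 \<le> r"
  using assms(1)
proof induction
  case (step n x y r z)
  then show ?case
    using assms(2)[of y z] chain_sum_in[OF step.hyps(1)] by simp
qed simp

lemma chain_sum_image:
  assumes "chain_sum f S n x y r" "h ` S \<subseteq> S"
    and "\<And>x y. x \<in> S \<Longrightarrow> y \<in> S \<Longrightarrow> f (h x) (h y) = f x y"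
  shows "chain_sum f S n (h x) (h y) r"
  using assms(1)
proof induction
  case (refl x)
  then show ?case using assms(2) by (auto intro: chain_sum.refl)
next
  case (step n x y r z)
  then have "chain_sum f S (Suc n) (h x) (h z) (r + f (h y) (h z))"
    using assms(2) by (auto intro: chain_sum.step)
  then show ?case
    using assms(3)[of y z] chain_sum_in[OF step.hyps(1)] step.hyps(2) by simp
qed

text \<open>
  The step from \<open>p\<close> to \<open>q\<close> is the one during which the partial sums pass \<open>t\<close>. With \<open>t = L / 2\<close> both
  remaining pieces have at most half the total, which drives the induction in
  \<open>chain_sum_bound\<close>.
\<close>

lemma chain_sum_split:
  assumes "chain_sum f S n x y L" "0 < n" "0 \<le> t" "t \<le> L"
    and "\<And>x y. x \<in> S \<Longrightarrow> y \<in> S \<Longrightarrow> 0 \<le> f x y"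
  shows "\<exists>i j p q u v. chain_sum f S i x p u \<and> chain_sum f S j q y v \<and> i < n \<and> j < n \<and>
           u \<le> t \<and> v \<le> L - t \<and> f p q \<le> L"
  using assms(1-4)
proof induction
  case (step n x y r z)
  have yS: "y \<in> S" and r0: "0 \<le> r" and f0: "0 \<le> f y z"
    using step.hyps chain_sum_in[OF step.hyps(1)] chain_sum_nonneg[OF step.hyps(1)] assms(5) by auto
  show ?case
  proof (cases "t < r")
    case False
    \<comment> \<open>The last step passes \<open>t\<close>, so the second piece is the trivial
      chain at \<open>z\<close>.\<close>
    have "chain_sum f S 0 z z 0"
      using step.hyps by (auto intro: chain_sum.refl)
    then have "chain_sum f S n x y r \<and> chain_sum f S 0 z z 0 \<and> n < Suc n \<and> 0 < Suc n \<and>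
        r \<le> t \<and> 0 \<le> r + f y z - t \<and> f y z \<le> r + f y z"
      using step.hyps(1) False step.prems r0 by auto
    then show ?thesis by blast
  next
    case True
    \<comment> \<open>A chain of length 0 has sum 0, while here \<open>r\<close> exceeds
      \<open>t \<ge> 0\<close>. The crossing thus happens within the first \<open>n\<close> steps,
      and the last step only lengthens the second piece.\<close>
    then have "n \<noteq> 0"
      using step.hyps(1) step.prems by (auto elim: chain_sum.cases)
    then obtain i j p q u v where *: "chain_sum f S i x p u" "chain_sum f S j q y v" "i < n" "j < n"
      "u \<le> t" "v \<le> r - t" "f p q \<le> r"
      using step.IH True step.prems by fastforce
    have "chain_sum f S (Suc j) q z (v + f y z)"
      using * step.hyps by (auto intro: chain_sum.step)
    then have "chain_sum f S i x p u \<and> chain_sum f S (Suc j) q z (v + f y z) \<and> i < Suc n \<and>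
        Suc j < Suc n \<and> u \<le> t \<and> v + f y z \<le> r + f y z - t \<and> f p q \<le> r + f y z"
      using * f0 by auto
    then show ?thesis by blast
  qed
qed simp

lemma chain_sum_bound:
  assumes nonneg: "\<And>x y. x \<in> S \<Longrightarrow> y \<in> S \<Longrightarrow> 0 \<le> f x y"
    and diag: "\<And>x. x \<in> S \<Longrightarrow> f x x = 0"
    and quad: "\<forall>a\<in>S. \<forall>b\<in>S. \<forall>c\<in>S. \<forall>d\<in>S. f a d \<le> 2 * max (f a b) (max (f b c) (f c d))"
    and "chain_sum f S n x y L"
  shows "f x y \<le> 2 * L"
  using assms(4)
proof (induction n arbitrary: x y L rule: less_induct)
  case (less n)
  have L: "0 \<le> L"
    using chain_sum_nonneg less.prems nonneg by metis
  show ?case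
  proof (cases "n = 0")
    case True
    then show ?thesis
      using less.prems diag by (auto elim: chain_sum.cases)
  next
    case False
    then obtain i j p q u v where *: "chain_sum f S i x p u" "chain_sum f S j q y v"
      "i < n" "j < n" "u \<le> L / 2" "v \<le> L - L / 2" "f p q \<le> L"
      using chain_sum_split[OF less.prems, of "L / 2"] nonneg L by auto
    \<comment> \<open>The induction loses a factor 2 on sums of at most \<open>L / 2\<close>, so all
      three links end up at most \<open>L\<close> and \<open>quad\<close> is applied only once: the
      constant 2 does not accumulate.\<close>
    have "f x p \<le> 2 * u" "f q y \<le> 2 * v"
      using less.IH[OF *(3,1)] less.IH[OF *(4,2)] by auto
    then have "f x p \<le> L" "f q y \<le> L"
      using *(5,6) by linarith+
    then have "max (f x p) (max (f p q) (f q y)) \<le> L"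
      using *(7) by simp
    moreover have "f x y \<le> 2 * max (f x p) (max (f p q) (f q y))"
      using quad chain_sum_in[OF *(1)] chain_sum_in[OF *(2)] by blast
    ultimately show ?thesis by linarith
  qed
qed

text \<open>For nonnegative \<open>f\<close> this is the largest function on pairs from
  \<open>S\<close> that lies below \<open>f\<close>, vanishes on the diagonal and satisfies the
  triangle inequality.\<close>

definition chain_dist :: "('a \<Rightarrow> 'a \<Rightarrow> real) \<Rightarrow> 'a set \<Rightarrow> 'a \<Rightarrow> 'a \<Rightarrow> real" where
  "chain_dist f S x y = Inf {r. \<exists>n. chain_sum f S n x y r}"

context
  fixes f :: "'a \<Rightarrow> 'a \<Rightarrow> real" and S :: "'a set"
  assumes nonneg: "\<And>x y. x \<in> S \<Longrightarrow> y \<in> S \<Longrightarrow> 0 \<le> f x y"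
begin

lemma bdd_below_chain_sums: "bdd_below {r. \<exists>n. chain_sum f S n x y r}"
  by (rule bdd_belowI[of _ 0]) (auto dest!: chain_sum_nonneg[of f S, OF _ nonneg])

lemma chain_dist_le:
  assumes "chain_sum f S n x y r"
  shows "chain_dist f S x y \<le> r"
  unfolding chain_dist_def using assms by (auto intro: cInf_lower bdd_below_chain_sums)

lemma chain_dist_geI:
  assumes "x \<in> S" "y \<in> S" "\<And>n r. chain_sum f S n x y r \<Longrightarrow> c \<le> r"
  shows "c \<le> chain_dist f S x y"
  unfolding chain_dist_def
proof (rule cInf_greatest)
  show "{r. \<exists>n. chain_sum f S n x y r} \<noteq> {}"
    using chain_sum_single[OF assms(1,2)] by blast
qed (use assms(3) in auto)

lemma chain_dist_le_single:
  assumes "x \<in> S" "y \<in> S"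
  shows "chain_dist f S x y \<le> f x y"
  by (rule chain_dist_le[OF chain_sum_single[OF assms]])

lemma chain_dist_nonneg:
  assumes "x \<in> S" "y \<in> S"
  shows "0 \<le> chain_dist f S x y"
  by (rule chain_dist_geI[OF assms chain_sum_nonneg[of f S, OF _ nonneg]])

lemma chain_dist_refl:
  assumes "x \<in> S"
  shows "chain_dist f S x x = 0"
  using chain_dist_le[OF chain_sum.refl[OF assms]] chain_dist_nonneg[OF assms assms] by simp

lemma chain_dist_sym:
  assumes "\<And>x y. x \<in> S \<Longrightarrow> y \<in> S \<Longrightarrow> f x y = f y x"
  shows "chain_dist f S x y = chain_dist f S y x"
proof -
  have "chain_sum f S n x y r \<longleftrightarrow> chain_sum f S n y x r" for n r
    using chain_sum_sym[of f S, OF _ assms] by blast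
  then show ?thesis by (simp add: chain_dist_def)
qed

text \<open>Concatenation adds sums. The two infima are taken one at a time, with the other term
  moved to the left-hand side.\<close>

lemma chain_dist_triangle:
  assumes "x \<in> S" "y \<in> S" "z \<in> S"
  shows "chain_dist f S x z \<le> chain_dist f S x y + chain_dist f S y z"
proof -
  have "chain_dist f S x z - s \<le> chain_dist f S x y" if "chain_sum f S m y z s" for m s
  proof (rule chain_dist_geI[OF assms(1,2)])
    show "chain_dist f S x z - s \<le> r" if "chain_sum f S n x y r" for n r
      using chain_dist_le[OF chain_sum_trans[OF \<open>chain_sum f S m y z s\<close> that]] by simp
  qed
  then have "chain_dist f S x z - chain_dist f S x y \<le> s" if "chain_sum f S m y z s" for m s
    using that by (simp add: algebra_simps)
  then have "chain_dist f S x z - chain_dist f S x y \<le> chain_dist f S y z"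
    by (rule chain_dist_geI[OF assms(2,3)])
  then show ?thesis by simp
qed

text \<open>Maps that preserve \<open>f\<close> send chains to chains of the same sum. For group
  elements equality follows by applying this to an inverse as well.\<close>

lemma chain_dist_image_le:
  assumes "x \<in> S" "y \<in> S" "h ` S \<subseteq> S"
    and "\<And>x y. x \<in> S \<Longrightarrow> y \<in> S \<Longrightarrow> f (h x) (h y) = f x y"
  shows "chain_dist f S (h x) (h y) \<le> chain_dist f S x y"
  by (rule chain_dist_geI[OF assms(1,2)]) (rule chain_dist_le[OF chain_sum_image[of f S, OF _ assms(3,4)]])

text \<open>The core of the metrization lemma for uniform spaces: passing from \<open>f\<close> to
  infima over chains loses at most a factor 2. With \<open>chain_dist_le_single\<close> it makes
  \<open>f\<close> and \<open>chain_dist f S\<close> comparable.\<close>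

lemma chain_dist_ge_half:
  assumes "x \<in> S" "y \<in> S"
    and "\<And>x. x \<in> S \<Longrightarrow> f x x = 0"
    and "\<forall>a\<in>S. \<forall>b\<in>S. \<forall>c\<in>S. \<forall>d\<in>S. f a d \<le> 2 * max (f a b) (max (f b c) (f c d))"
  shows "f x y \<le> 2 * chain_dist f S x y"
proof -
  have "f x y / 2 \<le> chain_dist f S x y"
  proof (rule chain_dist_geI[OF assms(1,2)])
    show "f x y / 2 \<le> r" if "chain_sum f S n x y r" for n r
      using chain_sum_bound[of S f, OF nonneg assms(3,4) that] by simp
  qed
  then show ?thesis by simp
qed

end

section \<open>Invariant entourages\<close>

lemma ex_dyadic_level:
  fixes r :: real
  assumes "0 < r"
  shows "\<exists>k::int. 2 powi k \<le> r \<and> r < 2 powi (k + 1)"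
proof -
  have "2 powr real_of_int \<lfloor>log 2 r\<rfloor> \<le> r \<and> r < 2 powr (real_of_int \<lfloor>log 2 r\<rfloor> + 1)"
    using floor_log_eq_powr_iff[of r 2 "\<lfloor>log 2 r\<rfloor>"] assms by simp
  moreover have "2 powr (real_of_int \<lfloor>log 2 r\<rfloor> + 1) = 2 powi (\<lfloor>log 2 r\<rfloor> + 1)"
    using powr_real_of_int'[of 2 "\<lfloor>log 2 r\<rfloor> + 1"] by simp
  ultimately show ?thesis
    using powr_real_of_int'[of 2 "\<lfloor>log 2 r\<rfloor>"] by auto
qed

text \<open>The scale is two-sided, so the value 0 is possible: it occurs for pairs lying in
  \<open>F k\<close> for arbitrarily negative \<open>k\<close>. For a pair in no \<open>F k\<close>
  the infimum is over the empty set and carries no meaning, so the estimates concern pairs in the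
  union.\<close>

definition dyadic_level :: "(int \<Rightarrow> ('a \<times> 'a) set) \<Rightarrow> 'a \<Rightarrow> 'a \<Rightarrow> real" where
  "dyadic_level F x y = Inf {2 powi k | k. (x, y) \<in> F k}"

lemma dyadic_level_le:
  assumes "(x, y) \<in> F k"
  shows "dyadic_level F x y \<le> 2 powi k"
  unfolding dyadic_level_def using assms by (intro cInf_lower bdd_belowI[of _ 0]) auto

text \<open>Some exponent \<open>j\<close> with \<open>(x, y) \<in> F j\<close> is strictly below
  \<open>k + 1\<close>, hence at most \<open>k\<close>, and \<open>F\<close> is increasing. This
  rounding later absorbs a factor 2.\<close>

lemma dyadic_level_less:
  assumes "mono F" "(x, y) \<in> \<Union>(range F)" "dyadic_level F x y < 2 powi (k + 1)"
  shows "(x, y) \<in> F k"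
proof -
  obtain j where j: "(x, y) \<in> F j" "(2::real) powi j < 2 powi (k + 1)"
    using cInf_lessD[of "{(2::real) powi j | j. (x, y) \<in> F j}" "2 powi (k + 1)"] assms(2,3)
    unfolding dyadic_level_def by auto
  then have "j \<le> k"
    using power_int_increasing[of "k + 1" j "2::real"] by force
  then show ?thesis
    using monoD[OF assms(1)] j(1) by blast
qed

lemma dyadic_level_nonneg:
  assumes "(x, y) \<in> \<Union>(range F)"
  shows "0 \<le> dyadic_level F x y"
  unfolding dyadic_level_def using assms by (intro cInf_greatest) auto

text \<open>Three links in a common \<open>F j\<close> compose to a pair in
  \<open>F (j + 1)\<close>, so the level at most doubles. Levels are infima that may be 0, so the
  argument runs by contradiction from a positive level of \<open>(a, d)\<close>.\<close>

lemma dyadic_level_quasi_ultrametric: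
  assumes "mono F" "\<Union>(range F) = S \<times> S" "\<And>k. F k O F k O F k \<subseteq> F (k + 1)"
    and "a \<in> S" "b \<in> S" "c \<in> S" "d \<in> S"
  shows "dyadic_level F a d
      \<le> 2 * max (dyadic_level F a b) (max (dyadic_level F b c) (dyadic_level F c d))"
    (is "?f a d \<le> 2 * ?M")
proof (rule ccontr)
  assume "\<not> ?thesis"
  then have gt: "2 * ?M < ?f a d" by simp
  have S: "(a, d) \<in> \<Union>(range F)" "(a, b) \<in> \<Union>(range F)" "(b, c) \<in> \<Union>(range F)"
      "(c, d) \<in> \<Union>(range F)"
    using assms by auto
  have "0 \<le> ?M"
    using dyadic_level_nonneg[OF S(2)] by simp
  with gt have "0 < ?f a d" by linarith
  then obtain k where k: "2 powi k \<le> ?f a d" "?f a d < 2 powi (k + 1)"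
    using ex_dyadic_level by blast
  have half: "2 * 2 powi (k - 1) = (2::real) powi k"
    by (simp add: power_int_diff)
  \<comment> \<open>nonzero values of \<open>dyadic_level F\<close> are powers of 2\<close>
  have "?f a d \<le> 2 powi k"
    using dyadic_level_less[OF assms(1) S(1) k(2)] by (rule dyadic_level_le)
  moreover have e: "(2::real) powi (k - 2 + 1) = 2 powi (k - 1)"
    by (rule arg_cong[where f = "power_int 2"]) simp
  ultimately have "?M < 2 powi (k - 2 + 1)"
    using gt half e by linarith
  \<comment> \<open>Two below \<open>k\<close>: a level below \<open>2 powi (k - 1)\<close> gives
    membership in \<open>F (k - 2)\<close>, and composition puts \<open>(a, d)\<close> into
    \<open>F (k - 1)\<close>, a full factor 2 below its level \<open>2 powi k\<close>.\<close>
  then have "(a, b) \<in> F (k - 2)" "(b, c) \<in> F (k - 2)" "(c, d) \<in> F (k - 2)"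
    by (intro dyadic_level_less[OF assms(1)] S; simp)+
  then have "(a, d) \<in> F (k - 2 + 1)"
    using assms(3)[of "k - 2"] by blast
  then have "?f a d \<le> 2 powi (k - 1)"
    using dyadic_level_le[of a d F "k - 2 + 1"] by simp
  moreover have "(0::real) < 2 powi (k - 1)" by simp
  ultimately show False
    using k(1) half by linarith
qed

section \<open>Groups acting by homeomorphisms\<close>

locale homeomorphism_action =
  fixes X :: "'a topology" and G :: "('a \<Rightarrow> 'a) set"
  assumes homeomorphism_group: "homeomorphism_group X G"
begin

lemma homeomorphic_map_action: "g \<in> G \<Longrightarrow> homeomorphic_map X X g"
  using homeomorphism_group by (auto simp: homeomorphism_group_def)

lemma action_in_topspace: "g \<in> G \<Longrightarrow> x \<in> topspace X \<Longrightarrow> g x \<in> topspace X"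
  using homeomorphic_imp_surjective_map[OF homeomorphic_map_action] by blast

lemma G_subset_Bij: "G \<subseteq> Bij (topspace X)"
  using homeomorphism_group subgroup.subset
  by (fastforce simp: homeomorphism_group_def BijGroup_def)

text \<open>Existence of an element acting as the inverse on \<open>topspace X\<close> hides the
  extensional encoding of \<open>BijGroup\<close>. The identity and composition are treated the same
  way.\<close>

lemma ex_inverse:
  assumes "g \<in> G"
  shows "\<exists>h\<in>G. \<forall>x\<in>topspace X. h (g x) = x \<and> g (h x) = x"
proof -
  let ?S = "topspace X"
  have g: "g \<in> Bij ?S"
    using assms G_subset_Bij by blast
  have "m_inv (BijGroup ?S) g \<in> G"
    using homeomorphism_group assms subgroup.m_inv_closed
    by (fastforce simp: homeomorphism_group_def)
  moreover have "bij_betw g ?S ?S"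
    using g by (simp add: Bij_def)
  ultimately show ?thesis
    unfolding inv_BijGroup[OF g]
    by (intro bexI) (auto simp: bij_betw_inv_into_left bij_betw_inv_into_right
        action_in_topspace[OF assms])
qed

lemma ex_identity: "\<exists>e\<in>G. \<forall>x\<in>topspace X. e x = x"
proof -
  have "\<one>\<^bsub>BijGroup (topspace X)\<^esub> \<in> G"
    using homeomorphism_group subgroup.one_closed by (fastforce simp: homeomorphism_group_def)
  then show ?thesis
    by (intro bexI) (auto simp: BijGroup_def)
qed

lemma ex_composition:
  assumes "g \<in> G" "h \<in> G"
  shows "\<exists>k\<in>G. \<forall>x\<in>topspace X. k x = g (h x)"
proof -
  have "g \<otimes>\<^bsub>BijGroup (topspace X)\<^esub> h \<in> G"
    using homeomorphism_group assms subgroup.m_closed by (fastforce simp: homeomorphism_group_def)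
  then have "compose (topspace X) g h \<in> G"
    using assms G_subset_Bij by (auto simp: BijGroup_def subset_iff)
  then show ?thesis
    by (intro bexI[of _ "compose (topspace X) g h"]) (auto simp: compose_def)
qed

lemma openin_action: "g \<in> G \<Longrightarrow> openin X U \<Longrightarrow> openin X (g ` U)"
  using homeomorphic_imp_open_map[OF homeomorphic_map_action] by (auto simp: open_map_def)

lemma compactin_action: "g \<in> G \<Longrightarrow> compactin X K \<Longrightarrow> compactin X (g ` K)"
  using homeomorphic_imp_continuous_map[OF homeomorphic_map_action] image_compactin by blast

text \<open>These are the symmetric invariant neighbourhoods of the diagonal. Halving is no part of
  the notion; it is derived later from conditions on the action.\<close>

definition entourage :: "('a \<times> 'a) set \<Rightarrow> bool" where
  "entourage E \<longleftrightarrow> E \<subseteq> topspace X \<times> topspace X \<and> sym E \<and>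
     (\<forall>g\<in>G. \<forall>x y. (x, y) \<in> E \<longrightarrow> (g x, g y) \<in> E) \<and>
     (\<forall>x\<in>topspace X. \<exists>N. openin X N \<and> x \<in> N \<and> N \<times> N \<subseteq> E)"

lemma entourage_subset: "entourage E \<Longrightarrow> E \<subseteq> topspace X \<times> topspace X"
  by (simp add: entourage_def)

lemma entourage_sym: "entourage E \<Longrightarrow> (x, y) \<in> E \<Longrightarrow> (y, x) \<in> E"
  by (auto simp: entourage_def dest: symD)

lemma entourage_action: "entourage E \<Longrightarrow> g \<in> G \<Longrightarrow> (x, y) \<in> E \<Longrightarrow> (g x, g y) \<in> E"
  by (auto simp: entourage_def)

lemma entourage_nhd:
  assumes "entourage E" "x \<in> topspace X"
  obtains N where "openin X N" "x \<in> N" "N \<times> N \<subseteq> E"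
  using assms unfolding entourage_def by blast

lemma entourage_refl: "entourage E \<Longrightarrow> x \<in> topspace X \<Longrightarrow> (x, x) \<in> E"
  by (rule entourage_nhd) blast+

lemma entourage_subset_comp:
  assumes "entourage E"
  shows "E \<subseteq> E O E"
proof clarify
  fix x y
  assume xy: "(x, y) \<in> E"
  then have "(x, x) \<in> E"
    using entourage_refl[OF assms] entourage_subset[OF assms] by blast
  with xy show "(x, y) \<in> E O E" by (rule relcompI[rotated])
qed

lemma entourage_subset_comp3:
  assumes "entourage E"
  shows "E \<subseteq> E O E O E"
  by (meson entourage_subset_comp[OF assms] relcomp_mono order_trans order_refl)

lemma entourage_action_iff:
  assumes "entourage E" "g \<in> G" "x \<in> topspace X" "y \<in> topspace X"
  shows "(g x, g y) \<in> E \<longleftrightarrow> (x, y) \<in> E"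
proof -
  obtain h where "h \<in> G" "\<forall>x\<in>topspace X. h (g x) = x"
    using ex_inverse[OF assms(2)] by blast
  then show ?thesis
    using entourage_action[OF assms(1)] assms by metis
qed

lemma entourage_Int:
  assumes "entourage D" "entourage E"
  shows "entourage (D \<inter> E)"
proof -
  have "\<exists>N. openin X N \<and> x \<in> N \<and> N \<times> N \<subseteq> D \<inter> E" if x: "x \<in> topspace X" for x
  proof -
    obtain M where "openin X M" "x \<in> M" "M \<times> M \<subseteq> D"
      using entourage_nhd[OF assms(1) x] .
    moreover obtain N where "openin X N" "x \<in> N" "N \<times> N \<subseteq> E"
      using entourage_nhd[OF assms(2) x] .
    ultimately show ?thesis
      by (intro exI[of _ "M \<inter> N"]) auto
  qed
  then show ?thesis
    using assms by (auto simp: entourage_def intro: sym_Int)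
qed

lemma entourage_mono:
  assumes "entourage D" "D \<subseteq> E" "E \<subseteq> topspace X \<times> topspace X" "sym E"
    and "\<And>g x y. g \<in> G \<Longrightarrow> (x, y) \<in> E \<Longrightarrow> (g x, g y) \<in> E"
  shows "entourage E"
proof -
  have "\<exists>N. openin X N \<and> x \<in> N \<and> N \<times> N \<subseteq> E" if x: "x \<in> topspace X" for x
  proof -
    obtain N where "openin X N" "x \<in> N" "N \<times> N \<subseteq> D"
      using entourage_nhd[OF assms(1) x] .
    with assms(2) show ?thesis by blast
  qed
  with assms(3-5) show ?thesis
    by (simp add: entourage_def)
qed

lemma entourage_comp3:
  assumes "entourage E"
  shows "entourage (E O E O E)"
proof (rule entourage_mono[OF assms])
  have E: "E \<subseteq> topspace X \<times> topspace X"
    using assms entourage_subset by blast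
  show "E \<subseteq> E O E O E"
    by (rule entourage_subset_comp3[OF assms])
  show "E O E O E \<subseteq> topspace X \<times> topspace X"
    using E by blast
  have "E\<inverse> = E"
    using assms by (simp add: entourage_def sym_conv_converse_eq)
  then show "sym (E O E O E)"
    by (simp add: sym_conv_converse_eq converse_relcomp O_assoc)
  show "(g x, g y) \<in> E O E O E" if g: "g \<in> G" and xy: "(x, y) \<in> E O E O E" for g x y
  proof -
    obtain u v where "(x, u) \<in> E" "(u, v) \<in> E" "(v, y) \<in> E"
      using xy by blast
    then have "(g x, g u) \<in> E" "(g u, g v) \<in> E" "(g v, g y) \<in> E"
      using entourage_action[OF assms g] by simp_all
    then show ?thesis by blast
  qed
qed

text \<open>The gauge is the chain pseudometric of the dyadic level of \<open>F\<close>. Every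
  \<open>F k\<close> is a neighbourhood of the diagonal, so the level is small near the diagonal and
  balls are open; \<open>cover\<close> gives every pair a level; the comparison with chains up to a
  factor 2 keeps balls inside the \<open>F k\<close>.\<close>

lemma ex_invariant_gauge:
  fixes F :: "int \<Rightarrow> ('a \<times> 'a) set"
  assumes ent: "\<And>k. entourage (F k)"
    and comp: "\<And>k. F k O F k O F k \<subseteq> F (k + 1)"
    and cover: "\<Union>(range F) = topspace X \<times> topspace X"
  shows "\<exists>\<rho>. gauge_on X \<rho> \<and> invariant_gauges X G {\<rho>} \<and>
    (\<forall>k. \<forall>x\<in>topspace X. gauge_ball X \<rho> x (2 powi k) \<subseteq> F k `` {x})"
proof -
  let ?S = "topspace X"
  define f where "f = dyadic_level F"
  define \<rho> where "\<rho> = chain_dist f ?S"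
  have F_Suc: "F k \<subseteq> F (k + 1)" for k
    using entourage_subset_comp3[OF ent] comp by (rule order_trans)
  have mono: "mono F"
  proof
    fix j k :: int
    assume "j \<le> k"
    then show "F j \<subseteq> F k"
      by (induction rule: int_ge_induct) (use F_Suc in blast)+
  qed
  have f0: "0 \<le> f x y" if "x \<in> ?S" "y \<in> ?S" for x y
    unfolding f_def using cover that by (intro dyadic_level_nonneg) blast
  have f_sym: "f x y = f y x" for x y
    using entourage_sym[OF ent] unfolding f_def dyadic_level_def by (metis (lifting))
  have f_le: "f x y \<le> 2 powi k" if "(x, y) \<in> F k" for x y k
    unfolding f_def using dyadic_level_le that by fast
  have f_less: "(x, y) \<in> F k" if "x \<in> ?S" "y \<in> ?S" "f x y < 2 powi (k + 1)" for x y k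
  proof -
    have "(x, y) \<in> \<Union>(range F)"
      unfolding cover using that(1,2) by blast
    then show ?thesis
      by (rule dyadic_level_less[OF mono _ that(3)[unfolded f_def]])
  qed
  have small: "\<exists>k. (2::real) powi k < e" if e: "0 < e" for e
  proof -
    obtain k where "(2::real) powi k \<le> e / 2"
      using ex_dyadic_level[OF half_gt_zero[OF e]] by auto
    then show ?thesis
      using e by (intro exI[of _ k]) simp
  qed
  \<comment> \<open>The pair \<open>(x, x)\<close> lies in every \<open>F k\<close>, also for
    arbitrarily negative \<open>k\<close>.\<close>
  have f_refl: "f x x = 0" if "x \<in> ?S" for x
  proof (rule antisym[OF field_le_epsilon f0[OF that that]])
    fix e :: real
    assume "0 < e"
    then obtain k where "(2::real) powi k < e"
      using small by blast
    then show "f x x \<le> 0 + e"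
      using f_le[OF entourage_refl[OF ent that], of k] by simp
  qed
  have quasi: "\<forall>a\<in>?S. \<forall>b\<in>?S. \<forall>c\<in>?S. \<forall>d\<in>?S. f a d \<le> 2 * max (f a b) (max (f b c) (f c d))"
    unfolding f_def using dyadic_level_quasi_ultrametric[OF mono cover comp] by blast
  have f_action: "f (g x) (g y) = f x y" if "g \<in> G" "x \<in> ?S" "y \<in> ?S" for g x y
    using entourage_action_iff[OF ent that] unfolding f_def dyadic_level_def by simp
  have le: "\<rho> (g x) (g y) \<le> \<rho> x y" if "g \<in> G" "x \<in> ?S" "y \<in> ?S" for g x y
    unfolding \<rho>_def using that f_action action_in_topspace
    by (intro chain_dist_image_le[OF f0]) auto
  have inv: "\<rho> (g x) (g y) = \<rho> x y" if g: "g \<in> G" and "x \<in> ?S" "y \<in> ?S" for g x y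
  proof (rule antisym[OF le[OF that]])
    obtain h where "h \<in> G" "\<forall>x\<in>?S. h (g x) = x"
      using ex_inverse[OF g] by blast
    then show "\<rho> x y \<le> \<rho> (g x) (g y)"
      using le[of h "g x" "g y"] that action_in_topspace by simp
  qed
  have tri: "\<rho> x z \<le> \<rho> x y + \<rho> y z" if "x \<in> ?S" "y \<in> ?S" "z \<in> ?S" for x y z
    unfolding \<rho>_def by (rule chain_dist_triangle[OF f0 that])
  have ball: "openin X (gauge_ball X \<rho> x e)" if "x \<in> ?S" for x e
    unfolding openin_subopen[of X "gauge_ball X \<rho> x e"]
  proof
    fix y
    assume "y \<in> gauge_ball X \<rho> x e"
    then have y: "y \<in> ?S" "\<rho> x y < e"
      by (auto simp: gauge_ball_def)
    \<comment> \<open>A scale so fine that a move from \<open>y\<close> within an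
      \<open>F k\<close>-small neighbourhood uses less than the remaining radius.\<close>
    then obtain k where k: "2 powi k < e - \<rho> x y"
      using small[of "e - \<rho> x y"] by auto
    obtain N where N: "openin X N" "y \<in> N" "N \<times> N \<subseteq> F k"
      using entourage_nhd[OF ent y(1)] .
    have "z \<in> gauge_ball X \<rho> x e" if "z \<in> N" for z
    proof -
      have z: "z \<in> ?S"
        using N(1) that openin_subset by blast
      have "\<rho> y z \<le> f y z"
        unfolding \<rho>_def by (rule chain_dist_le_single[OF f0 y(1) z])
      also have "\<dots> \<le> 2 powi k"
        using N that by (intro f_le) blast
      finally show ?thesis
        using tri[OF \<open>x \<in> ?S\<close> y(1) z] k z by (simp add: gauge_ball_def)
    qed
    with N show "\<exists>T. openin X T \<and> y \<in> T \<and> T \<subseteq> gauge_ball X \<rho> x e" by blast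
  qed
  have "0 \<le> \<rho> x y" "\<rho> x x = 0" "\<rho> x y = \<rho> y x" if "x \<in> ?S" "y \<in> ?S" for x y
    unfolding \<rho>_def by (rule chain_dist_nonneg[OF f0 that] chain_dist_refl[OF f0 that(1)]
        chain_dist_sym[of ?S f, OF f0 f_sym]; assumption)+
  with ball tri have "gauge_on X \<rho>"
    unfolding gauge_on_def by simp
  moreover have "gauge_ball X \<rho> x (2 powi k) \<subseteq> F k `` {x}" if "x \<in> ?S" for x k
  proof
    fix y
    assume "y \<in> gauge_ball X \<rho> x (2 powi k)"
    then have y: "y \<in> ?S" "\<rho> x y < 2 powi k"
      by (auto simp: gauge_ball_def)
    \<comment> \<open>The factor 2 is absorbed by rounding: a level strictly below
      \<open>2 powi (k + 1)\<close> already means membership in \<open>F k\<close>, so no index is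
      lost.\<close>
    have "f x y \<le> 2 * \<rho> x y"
      unfolding \<rho>_def by (rule chain_dist_ge_half[OF f0 that y(1) f_refl quasi])
    also have "\<dots> < 2 powi (k + 1)"
      using y(2) by (simp add: power_int_add)
    finally show "y \<in> F k `` {x}"
      using f_less[OF that y(1)] by blast
  qed
  ultimately show ?thesis
    using inv by (intro exI[of _ \<rho>]) (simp add: invariant_gauges_def)
qed

end

section \<open>Refining invariant entourages\<close>

definition saturated :: "('a \<Rightarrow> 'a) set \<Rightarrow> 'a set \<Rightarrow> bool" where
  "saturated G U \<longleftrightarrow> (\<forall>g\<in>G. \<forall>x\<in>U. g x \<in> U)"

context homeomorphism_action
begin

lemma orbit_of_action:
  assumes "g \<in> G" "x \<in> topspace X"
  shows "orbit_of G (g x) = orbit_of G x"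
proof
  show "orbit_of G (g x) \<subseteq> orbit_of G x"
  proof
    fix y
    assume "y \<in> orbit_of G (g x)"
    then obtain h where "h \<in> G" "y = h (g x)"
      by (auto simp: orbit_of_def)
    moreover obtain k where "k \<in> G" "\<forall>x\<in>topspace X. k x = h (g x)"
      using ex_composition[OF \<open>h \<in> G\<close> assms(1)] by blast
    ultimately have "y = k x" "k \<in> G"
      using assms(2) by simp_all
    then show "y \<in> orbit_of G x"
      by (auto simp: orbit_of_def)
  qed
  show "orbit_of G x \<subseteq> orbit_of G (g x)"
  proof
    fix y
    assume "y \<in> orbit_of G x"
    then obtain h where "h \<in> G" "y = h x"
      by (auto simp: orbit_of_def)
    moreover obtain i where i: "i \<in> G" "\<forall>x\<in>topspace X. i (g x) = x"
      using ex_inverse[OF assms(1)] by blast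
    moreover obtain k where "k \<in> G" "\<forall>x\<in>topspace X. k x = h (i x)"
      using ex_composition[OF \<open>h \<in> G\<close> \<open>i \<in> G\<close>] by blast
    ultimately have "y = k (g x)" "k \<in> G"
      using assms by (simp_all add: action_in_topspace)
    then show "y \<in> orbit_of G (g x)"
      by (auto simp: orbit_of_def)
  qed
qed

lemma in_orbit_of_self:
  assumes "x \<in> topspace X"
  shows "x \<in> orbit_of G x"
proof -
  obtain e where "e \<in> G" "\<forall>x\<in>topspace X. e x = x"
    using ex_identity by blast
  then have "x = e x" "e \<in> G"
    using assms by simp_all
  then show ?thesis
    unfolding orbit_of_def by blast
qed

lemma saturated_preimage_orbit_of:
  "saturated G {x \<in> topspace X. orbit_of G x \<in> A}"
  by (simp add: saturated_def action_in_topspace orbit_of_action)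

text \<open>Orbits partition the space, so a saturated set is recovered from its image. Hence
  saturated open sets have open images in the orbit space.\<close>

lemma preimage_orbit_of_image:
  assumes "saturated G U" "U \<subseteq> topspace X"
  shows "{x \<in> topspace X. orbit_of G x \<in> orbit_of G ` U} = U"
proof
  show "{x \<in> topspace X. orbit_of G x \<in> orbit_of G ` U} \<subseteq> U"
  proof clarify
    fix x u
    assume "x \<in> topspace X" "u \<in> U" "orbit_of G x = orbit_of G u"
    then have "x \<in> orbit_of G u"
      using in_orbit_of_self by metis
    then show "x \<in> U"
      using assms(1) \<open>u \<in> U\<close> by (auto simp: orbit_of_def saturated_def)
  qed
qed (use assms(2) in auto)

text \<open>Regularity of the orbit space pulled back along the quotient map: \<open>P\<close> and
  \<open>C\<close> are the preimages of a neighbourhood of the orbit of \<open>x\<close> and of its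
  closure.\<close>

lemma regular_saturated_nhd:
  assumes "regular_space (orbit_space X G)" "openin X U" "saturated G U" "x \<in> U"
  shows "\<exists>P C. openin X P \<and> saturated G P \<and> closedin X C \<and> saturated G C \<and>
           x \<in> P \<and> P \<subseteq> C \<and> C \<subseteq> U"
proof -
  let ?Q = "orbit_space X G" and ?q = "\<lambda>A. {x \<in> topspace X. orbit_of G x \<in> A}"
  have U: "U \<subseteq> topspace X"
    using assms(2) by (rule openin_subset)
  have "openin ?Q (orbit_of G ` U)"
    unfolding openin_orbit_space preimage_orbit_of_image[OF assms(3) U]
    using U assms(2) by (simp add: image_mono)
  moreover have "orbit_of G x \<in> orbit_of G ` U"
    using assms(4) by (rule imageI)
  ultimately obtain V where V: "openin ?Q V" "orbit_of G x \<in> V" "?Q closure_of V \<subseteq> orbit_of G ` U"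
    using assms(1) unfolding regular_space_iff_closure_of by meson
  have cont: "continuous_map X ?Q (orbit_of G)"
    by (rule quotient_imp_continuous_map[OF quotient_map_orbit_of])
  have "V \<subseteq> ?Q closure_of V"
    by (rule closure_of_subset[OF openin_subset[OF V(1)]])
  then have "?q V \<subseteq> ?q (?Q closure_of V)"
    by auto
  moreover have "?q (?Q closure_of V) \<subseteq> ?q (orbit_of G ` U)"
    using V(3) by auto
  then have "?q (?Q closure_of V) \<subseteq> U"
    by (simp only: preimage_orbit_of_image[OF assms(3) U])
  moreover have "x \<in> ?q V"
    using V(2) U assms(4) by auto
  ultimately show ?thesis
    using openin_continuous_map_preimage[OF cont V(1)]
      closedin_continuous_map_preimage[OF cont closedin_closure_of]
    by (intro exI[of _ "?q V"] exI[of _ "?q (?Q closure_of V)"])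
      (simp add: saturated_preimage_orbit_of)
qed

definition saturation :: "'a set \<Rightarrow> 'a set" where
  "saturation U = (\<Union>g\<in>G. g ` U)"

lemma saturated_saturation:
  assumes "U \<subseteq> topspace X"
  shows "saturated G (saturation U)"
  unfolding saturated_def
proof (intro ballI)
  fix g x
  assume g: "g \<in> G" and "x \<in> saturation U"
  then obtain h u where hu: "h \<in> G" "u \<in> U" "x = h u"
    by (auto simp: saturation_def)
  obtain k where k: "k \<in> G" "\<forall>x\<in>topspace X. k x = g (h x)"
    using ex_composition[OF g hu(1)] by blast
  then have "g x = k u"
    using hu assms by auto
  then show "g x \<in> saturation U"
    using k(1) hu(2) by (auto simp: saturation_def)
qed

lemma openin_saturation: "openin X U \<Longrightarrow> openin X (saturation U)"
  unfolding saturation_def by (intro openin_Union) (auto intro: openin_action)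

lemma subset_saturation:
  assumes "U \<subseteq> topspace X"
  shows "U \<subseteq> saturation U"
proof
  fix x
  assume "x \<in> U"
  moreover obtain e where "e \<in> G" "\<forall>x\<in>topspace X. e x = x"
    using ex_identity by blast
  ultimately have "x = e x" "e \<in> G"
    using assms by auto
  then show "x \<in> saturation U"
    using \<open>x \<in> U\<close> by (auto simp: saturation_def)
qed

text \<open>\<open>D\<close> is the union of the squares of all translates of the neighbourhoods
  that equiregularity provides. A translate containing a point of \<open>V\<close> meets the closure
  of \<open>V\<close> and therefore lies in \<open>U\<close>.\<close>

lemma ex_star_entourage:
  assumes "equiregular X G" "openin X U" "x \<in> U"
  shows "\<exists>V D. openin X V \<and> x \<in> V \<and> entourage D \<and> (\<forall>v\<in>V. D `` {v} \<subseteq> U)"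
proof -
  have x: "x \<in> topspace X"
    using openin_subset[OF assms(2)] assms(3) by blast
  obtain V where V: "openin X V" "x \<in> V"
    and "\<forall>y\<in>topspace X. \<exists>N. openin X N \<and> y \<in> N \<and>
           (\<forall>g\<in>G. g ` N \<inter> X closure_of V \<noteq> {} \<longrightarrow> g ` N \<subseteq> U)"
    using assms(1)[unfolded equiregular_def, THEN bspec, OF x, THEN spec, of U] assms(2,3)
    by (elim impE exE conjE) auto
  then obtain N where N: "\<And>y. y \<in> topspace X \<Longrightarrow> openin X (N y) \<and> y \<in> N y \<and>
      (\<forall>g\<in>G. g ` N y \<inter> X closure_of V \<noteq> {} \<longrightarrow> g ` N y \<subseteq> U)"
    by metis
  have V_sub: "V \<subseteq> X closure_of V"
    by (rule closure_of_subset[OF openin_subset[OF V(1)]])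
  define D where "D = (\<Union>y\<in>topspace X. \<Union>g\<in>G. g ` N y \<times> g ` N y)"
  have DI: "(a, b) \<in> D" if "y \<in> topspace X" "g \<in> G" "a \<in> g ` N y" "b \<in> g ` N y" for a b y g
    unfolding D_def using that by blast
  have DE: "\<exists>y\<in>topspace X. \<exists>g\<in>G. a \<in> g ` N y \<and> b \<in> g ` N y" if "(a, b) \<in> D" for a b
    using that unfolding D_def by blast
  have N_top: "N y \<subseteq> topspace X" if "y \<in> topspace X" for y
    using N[OF that] by (simp add: openin_subset)
  have "entourage D"
    unfolding entourage_def
  proof (intro conjI ballI allI impI)
    show "D \<subseteq> topspace X \<times> topspace X"
    proof clarify
      fix a b
      assume "(a, b) \<in> D"
      then obtain y g where "y \<in> topspace X" "g \<in> G" "a \<in> g ` N y" "b \<in> g ` N y"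
        using DE by blast
      then show "a \<in> topspace X \<and> b \<in> topspace X"
        using N_top[of y] by (auto simp: action_in_topspace subset_iff)
    qed
    show "sym D"
      unfolding D_def sym_def by blast
    show "(h a, h b) \<in> D" if h: "h \<in> G" and ab: "(a, b) \<in> D" for h a b
    proof -
      obtain y g where yg: "y \<in> topspace X" "g \<in> G" "a \<in> g ` N y" "b \<in> g ` N y"
        using DE[OF ab] by blast
      then obtain u v where uv: "u \<in> N y" "v \<in> N y" "a = g u" "b = g v" by blast
      obtain k where k: "k \<in> G" "\<forall>x\<in>topspace X. k x = h (g x)"
        using ex_composition[OF h yg(2)] by blast
      have "h a = k u" "h b = k v"
        using k(2) uv N_top[OF yg(1)] by auto
      then show ?thesis
        using DI[OF yg(1) k(1)] uv by blast
    qed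
    show "\<exists>M. openin X M \<and> y \<in> M \<and> M \<times> M \<subseteq> D" if y: "y \<in> topspace X" for y
    proof (intro exI conjI)
      obtain e where e: "e \<in> G" "\<forall>x\<in>topspace X. e x = x"
        using ex_identity by blast
      then have "e ` N y = N y"
        using N_top[OF y] by force
      then show "N y \<times> N y \<subseteq> D"
        using DI[OF y e(1)] by blast
    qed (use N[OF y] in simp_all)
  qed
  moreover have "D `` {v} \<subseteq> U" if v: "v \<in> V" for v
  proof
    fix b
    assume "b \<in> D `` {v}"
    then obtain y g where yg: "y \<in> topspace X" "g \<in> G" "v \<in> g ` N y" "b \<in> g ` N y"
      using DE by blast
    then have "g ` N y \<inter> X closure_of V \<noteq> {}"
      using v V_sub by blast
    then have "g ` N y \<subseteq> U"
      using N[OF yg(1)] yg(2) by simp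
    with yg(4) show "b \<in> U" by blast
  qed
  ultimately show ?thesis
    using V by blast
qed

text \<open>A paracompactness argument in the orbit space. The stars of \<open>D x\<close> are known
  to be small only over \<open>V x\<close>. Countably many of the saturated sets \<open>P i\<close>
  cover the space; removing the sets \<open>C j\<close> of earlier indices from the saturation of
  \<open>V i\<close> yields a locally finite saturated cover \<open>W\<close>, along which the
  relations \<open>D i\<close> are glued.\<close>

lemma ex_refining_entourage:
  assumes "sigma_compact_space X" "regular_space (orbit_space X G)" "equiregular X G"
    and U: "\<And>x. x \<in> topspace X \<Longrightarrow> openin X (U x) \<and> x \<in> U x"
  shows "\<exists>D. entourage D \<and> (\<forall>p\<in>topspace X. \<exists>x\<in>topspace X. \<exists>g\<in>G. D `` {p} \<subseteq> g ` U x)"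
proof -
  let ?S = "topspace X"
  have "\<exists>V D. openin X V \<and> x \<in> V \<and> entourage D \<and> (\<forall>v\<in>V. D `` {v} \<subseteq> U x)" if "x \<in> ?S" for x
    using ex_star_entourage[OF assms(3)] U[OF that] by blast
  then obtain V D where VD: "\<And>x. x \<in> ?S \<Longrightarrow>
      openin X (V x) \<and> x \<in> V x \<and> entourage (D x) \<and> (\<forall>v\<in>V x. D x `` {v} \<subseteq> U x)"
    by metis
  have V_top: "V x \<subseteq> ?S" if "x \<in> ?S" for x
    using VD[OF that] by (simp add: openin_subset)
  define R where "R x P C \<longleftrightarrow> openin X P \<and> saturated G P \<and> closedin X C \<and> saturated G C \<and>
      x \<in> P \<and> P \<subseteq> C \<and> C \<subseteq> saturation (V x)" for x P C
  have "\<exists>P C. R x P C" if "x \<in> ?S" for x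
    unfolding R_def
    using VD[OF that] V_top[OF that] subset_saturation[OF V_top[OF that]]
    by (intro regular_saturated_nhd[OF assms(2)] openin_saturation saturated_saturation) auto
  then obtain P C where R: "\<And>x. x \<in> ?S \<Longrightarrow> R x (P x) (C x)"
    by metis
  note PC = R[unfolded R_def]
  obtain \<K> where K: "countable \<K>" "\<forall>K\<in>\<K>. compactin X K" "\<Union>\<K> = ?S"
    using assms(1) unfolding sigma_compact_space_def by (elim exE conjE)
  have "\<exists>J. finite J \<and> J \<subseteq> ?S \<and> K \<subseteq> \<Union>(P ` J)" if "K \<in> \<K>" for K
  proof -
    have "compactin X K" "K \<subseteq> ?S"
      using K(2) compactin_subset_topspace that by auto
    moreover have "?S \<subseteq> \<Union>(P ` ?S)"
      using PC by auto
    moreover have "openin X U" if "U \<in> P ` ?S" for U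
      using PC that by auto
    ultimately obtain \<F> where "finite \<F>" "\<F> \<subseteq> P ` ?S" "K \<subseteq> \<Union>\<F>"
      using compactinD[of X K "P ` ?S"] subset_trans by metis
    then show ?thesis
      using finite_subset_image[of \<F> P ?S] by blast
  qed
  then obtain J where J: "\<And>K. K \<in> \<K> \<Longrightarrow> finite (J K) \<and> J K \<subseteq> ?S \<and> K \<subseteq> \<Union>(P ` J K)"
    by metis
  define I where "I = \<Union>(J ` \<K>)"
  have "countable (J K)" if "K \<in> \<K>" for K
    using J[OF that] by (simp add: countable_finite)
  then have "countable I"
    unfolding I_def using K(1) by (intro countable_UN)
  moreover have "I \<subseteq> ?S"
    unfolding I_def by (intro UN_least) (simp add: J)
  ultimately have I: "countable I" "I \<subseteq> ?S" .
  have I_cover: "\<exists>i\<in>I. y \<in> P i" if "y \<in> ?S" for y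
  proof -
    have "y \<in> \<Union>\<K>"
      unfolding K(3) by (rule that)
    then obtain K where "K \<in> \<K>" "y \<in> K" ..
    then show ?thesis
      using J[of K] unfolding I_def by blast
  qed
  \<comment> \<open>An injection of \<open>I\<close> into the naturals, so only finitely many
    indices lie below any bound.\<close>
  let ?n = "to_nat_on I"
  have fin: "finite {j \<in> I. ?n j \<le> m}" for m
    by (rule inj_on_finite[of ?n _ "{..m}"])
      (use I(1) inj_on_to_nat_on in \<open>auto intro: inj_on_subset\<close>)
  \<comment> \<open>\<open>W\<close> is locally finite: the open set \<open>P i\<close> misses every \<open>W j\<close> with \<open>j\<close> later than \<open>i\<close>.\<close>
  define W where "W x = saturation (V x) - \<Union>(C ` {j \<in> I. ?n j < ?n x})" for x
  have W_cover: "\<exists>i\<in>I. y \<in> W i" if y: "y \<in> ?S" for y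
  proof -
    \<comment> \<open>The first index whose saturated set contains \<open>y\<close> works: each
      \<open>C j\<close> lies in the saturation of \<open>V j\<close>, so \<open>y\<close> is in no
      earlier \<open>C j\<close>.\<close>
    define m where "m = (LEAST m. \<exists>i\<in>I. ?n i = m \<and> y \<in> saturation (V i))"
    have "\<exists>m. \<exists>i\<in>I. ?n i = m \<and> y \<in> saturation (V i)"
      using I_cover[OF y] PC I(2) by blast
    then have "\<exists>i\<in>I. ?n i = m \<and> y \<in> saturation (V i)"
      unfolding m_def by (rule LeastI_ex)
    then obtain i where i: "i \<in> I" "?n i = m" "y \<in> saturation (V i)" by blast
    have "y \<notin> C j" if j: "j \<in> I" "?n j < m" for j
    proof
      assume "y \<in> C j"
      then have "\<exists>i\<in>I. ?n i = ?n j \<and> y \<in> saturation (V i)"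
        using PC[of j] I(2) j(1) by blast
      then have "m \<le> ?n j"
        unfolding m_def by (rule Least_le)
      with j(2) show False by simp
    qed
    with i show ?thesis
      unfolding W_def by blast
  qed
  have W_sat: "g y \<in> W i \<longleftrightarrow> y \<in> W i" if "g \<in> G" "i \<in> I" "y \<in> ?S" for g y i
  proof -
    obtain h where h: "h \<in> G" "\<forall>x\<in>?S. h (g x) = x"
      using ex_inverse[OF \<open>g \<in> G\<close>] by blast
    have *: "g y \<in> A \<longleftrightarrow> y \<in> A" if "saturated G A" for A
      using that h \<open>g \<in> G\<close> \<open>y \<in> ?S\<close> unfolding saturated_def by metis
    have "saturated G (saturation (V i))"
      using saturated_saturation V_top that(2) I(2) by blast
    moreover have "saturated G (C j)" if "j \<in> I" for j
      using PC I(2) that by blast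
    ultimately show ?thesis
      unfolding W_def using * by auto
  qed
  \<comment> \<open>Testing both ends makes \<open>E\<close> symmetric, saturation of the
    \<open>W i\<close> makes it invariant, and local finiteness leaves finitely many conditions near
    each point.\<close>
  define E where "E = {(a, b) \<in> ?S \<times> ?S. \<forall>i\<in>I. a \<in> W i \<or> b \<in> W i \<longrightarrow> (a, b) \<in> D i}"
  have D: "entourage (D i)" if "i \<in> I" for i
    using VD I(2) that by blast
  have "entourage E"
    unfolding entourage_def
  proof (intro conjI ballI allI impI)
    show "E \<subseteq> ?S \<times> ?S"
      unfolding E_def by blast
    show "sym E"
      unfolding sym_def E_def using entourage_sym[OF D] by blast
    show "(g a, g b) \<in> E" if "g \<in> G" "(a, b) \<in> E" for g a b
      using that W_sat entourage_action[OF D] unfolding E_def by (simp add: action_in_topspace)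
    show "\<exists>N. openin X N \<and> y \<in> N \<and> N \<times> N \<subseteq> E" if y: "y \<in> ?S" for y
    proof -
      obtain k where k: "k \<in> I" "y \<in> P k"
        using I_cover[OF y] by blast
      let ?J = "{j \<in> I. ?n j \<le> ?n k}"
      have "\<exists>N. openin X N \<and> y \<in> N \<and> N \<times> N \<subseteq> D j" if "j \<in> I" for j
        using D[OF that] y unfolding entourage_def by blast
      then obtain N where N: "\<And>j. j \<in> I \<Longrightarrow> openin X (N j) \<and> y \<in> N j \<and> N j \<times> N j \<subseteq> D j"
        by metis
      let ?N = "P k \<inter> \<Inter>(N ` ?J)"
      have "?J \<noteq> {}"
        using k(1) by blast
      then have "openin X (\<Inter>(N ` ?J))"
        using N fin[of "?n k"] by (intro openin_Inter) auto
      then have "openin X ?N"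
        using PC[of k] I(2) k(1) by blast
      moreover have "y \<in> ?N"
        using k N by blast
      moreover have "(a, b) \<in> E" if ab: "a \<in> ?N" "b \<in> ?N" for a b
      proof -
        have "a \<in> ?S" "b \<in> ?S"
          using openin_subset[OF \<open>openin X ?N\<close>] ab by blast+
        moreover have "(a, b) \<in> D i" if i: "i \<in> I" "a \<in> W i \<or> b \<in> W i" for i
        proof -
          have "a \<in> C k" "b \<in> C k"
            using ab PC[of k] I(2) k(1) by blast+
          then have "\<not> ?n k < ?n i"
            using i k(1) unfolding W_def by blast
          then have "i \<in> ?J"
            using i(1) by simp
          then have "a \<in> N i" "b \<in> N i"
            using ab by blast+
          then show ?thesis
            using N[OF i(1)] by blast
        qed
        ultimately show ?thesis
          unfolding E_def by blast
      qed
      ultimately show ?thesis by blast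
    qed
  qed
  moreover have "\<exists>x\<in>?S. \<exists>g\<in>G. E `` {p} \<subseteq> g ` U x" if p: "p \<in> ?S" for p
  proof -
    obtain i where i: "i \<in> I" "p \<in> W i"
      using W_cover[OF p] by blast
    then have "p \<in> saturation (V i)"
      unfolding W_def by blast
    then obtain g v where g: "g \<in> G" and v: "v \<in> V i" "p = g v"
      unfolding saturation_def by blast
    have i_S: "i \<in> ?S"
      using i(1) I(2) by blast
    have v_S: "v \<in> ?S"
      using v(1) V_top[OF i_S] by blast
    \<comment> \<open>The star bound for \<open>D i\<close> holds at points of \<open>V i\<close>,
      so \<open>p\<close> is moved to \<open>v\<close> by \<open>h\<close> and the conclusion is
      carried back by \<open>g\<close>.\<close>
    obtain h where h: "h \<in> G" "\<forall>x\<in>?S. h (g x) = x \<and> g (h x) = x"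
      using ex_inverse[OF g] by blast
    have "b \<in> g ` U i" if b: "b \<in> E `` {p}" for b
    proof -
      have "(p, b) \<in> D i" and b_S: "b \<in> ?S"
        using b i unfolding E_def by blast+
      then have "(h p, h b) \<in> D i"
        using entourage_action[OF D[OF i(1)] h(1)] by blast
      then have "h b \<in> D i `` {v}"
        using h(2) v(2) v_S by auto
      then have "h b \<in> U i"
        using VD[OF i_S] v(1) by blast
      moreover have "b = g (h b)"
        using h(2) b_S by simp
      ultimately show ?thesis by blast
    qed
    then show ?thesis
      using i_S g by blast
  qed
  ultimately show ?thesis by blast
qed

text \<open>Refine the cover by neighbourhoods \<open>N x\<close> whose squares lie in
  \<open>E\<close>. If \<open>a\<close> and \<open>b\<close> are both \<open>D\<close>-related to
  \<open>p\<close>, they share one translate of some \<open>N x\<close>, and the square of that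
  translate lies in \<open>E\<close> by invariance.\<close>

lemma ex_half_entourage:
  assumes "sigma_compact_space X" "regular_space (orbit_space X G)" "equiregular X G"
    and "entourage E"
  shows "\<exists>D. entourage D \<and> D O D \<subseteq> E"
proof -
  have "\<exists>N. openin X N \<and> x \<in> N \<and> N \<times> N \<subseteq> E" if "x \<in> topspace X" for x
    using assms(4) that unfolding entourage_def by blast
  then obtain N where N: "\<And>x. x \<in> topspace X \<Longrightarrow> openin X (N x) \<and> x \<in> N x \<and> N x \<times> N x \<subseteq> E"
    by metis
  obtain D where D: "entourage D"
    and star: "\<forall>p\<in>topspace X. \<exists>x\<in>topspace X. \<exists>g\<in>G. D `` {p} \<subseteq> g ` N x"
    using ex_refining_entourage[OF assms(1-3), of N] N by blast
  have "(a, b) \<in> E" if ab: "(a, p) \<in> D" "(p, b) \<in> D" for a p b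
  proof -
    have "p \<in> topspace X"
      using ab entourage_subset[OF D] by blast
    then obtain x g where xg: "x \<in> topspace X" "g \<in> G" "D `` {p} \<subseteq> g ` N x"
      using star by blast
    then have "a \<in> g ` N x" "b \<in> g ` N x"
      using ab entourage_sym[OF D] by blast+
    then show ?thesis
      using N[OF xg(1)] entourage_action[OF assms(4) xg(2)] by blast
  qed
  with D show ?thesis by blast
qed

text \<open>Halving twice suffices: \<open>D O D\<close> fits into \<open>H\<close>, and so does the
  remaining single factor \<open>D\<close>.\<close>

lemma ex_third_entourage:
  assumes "sigma_compact_space X" "regular_space (orbit_space X G)" "equiregular X G"
    and "entourage E"
  shows "\<exists>D. entourage D \<and> D O D O D \<subseteq> E"
proof -
  obtain H where H: "entourage H" "H O H \<subseteq> E"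
    using ex_half_entourage[OF assms] by blast
  obtain D where D: "entourage D" "D O D \<subseteq> H"
    using ex_half_entourage[OF assms(1-3) H(1)] by blast
  have "D \<subseteq> H"
    using entourage_subset_comp[OF D(1)] D(2) by (rule order_trans)
  then have "D O (D O D) \<subseteq> H O H"
    using D(2) by (rule relcomp_mono)
  with H(2) D(1) show ?thesis
    by (intro exI[of _ D]) simp
qed

end

section \<open>Topologies determined by gauges\<close>

lemma gauge_on_refl:
  assumes "gauge_on X \<rho>" "x \<in> topspace X"
  shows "\<rho> x x = 0"
  using assms by (auto simp: gauge_on_def)

lemma gauge_on_sym:
  assumes "gauge_on X \<rho>" "x \<in> topspace X" "y \<in> topspace X"
  shows "\<rho> x y = \<rho> y x"
  using assms by (auto simp: gauge_on_def)

lemma gauge_on_triangle: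
  assumes "gauge_on X \<rho>" "x \<in> topspace X" "y \<in> topspace X" "z \<in> topspace X"
  shows "\<rho> x z \<le> \<rho> x y + \<rho> y z"
  using assms by (auto simp: gauge_on_def)

lemma openin_gauge_ball:
  assumes "gauge_on X \<rho>" "x \<in> topspace X" "0 < \<epsilon>"
  shows "openin X (gauge_ball X \<rho> x \<epsilon>)"
  using assms by (auto simp: gauge_on_def)

lemma openin_gauge_balls:
  assumes "finite \<F>" "\<And>\<rho>. \<rho> \<in> \<F> \<Longrightarrow> gauge_on X \<rho>" "x \<in> topspace X" "0 < \<epsilon>"
  shows "openin X {y \<in> topspace X. \<forall>\<rho>\<in>\<F>. \<rho> x y < \<epsilon>}"
proof -
  have "openin X ((\<Inter>\<rho>\<in>\<F>. gauge_ball X \<rho> x \<epsilon>) \<inter> topspace X)"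
    using assms by (intro openin_INT) (auto intro: openin_gauge_ball)
  moreover have "(\<Inter>\<rho>\<in>\<F>. gauge_ball X \<rho> x \<epsilon>) \<inter> topspace X
      = {y \<in> topspace X. \<forall>\<rho>\<in>\<F>. \<rho> x y < \<epsilon>}"
    by (auto simp: gauge_ball_def)
  ultimately show ?thesis by simp
qed

lemma openin_gauge_topology_imp_openin:
  assumes "\<forall>\<rho>\<in>\<P>. gauge_on X \<rho>" "openin (gauge_topology X \<P>) U"
  shows "openin X U"
proof (rule minimal_topology_subbase)
  show "openin (topology (arbitrary union_of (finite intersection_of
      (\<lambda>S. \<exists>\<rho>\<in>\<P>. \<exists>x\<in>topspace X. \<exists>\<epsilon>>0. S = gauge_ball X \<rho> x \<epsilon>) relative_to topspace X))) U"
    using assms(2) unfolding gauge_topology_def .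
qed (use assms(1) in \<open>auto intro!: openin_gauge_ball\<close>)

lemma openin_gauge_topology_gauge_ball:
  assumes "\<rho> \<in> \<P>" "x \<in> topspace X" "0 < \<epsilon>"
  shows "openin (gauge_topology X \<P>) (gauge_ball X \<rho> x \<epsilon>)"
proof -
  let ?B = "\<lambda>S. \<exists>\<rho>\<in>\<P>. \<exists>x\<in>topspace X. \<exists>\<epsilon>>0. S = gauge_ball X \<rho> x \<epsilon>"
  have "?B (gauge_ball X \<rho> x \<epsilon>)"
    using assms by auto
  then have "(finite intersection_of ?B) (gauge_ball X \<rho> x \<epsilon>)"
    by (rule finite_intersection_of_inc)
  then have "(finite intersection_of ?B relative_to topspace X) (topspace X \<inter> gauge_ball X \<rho> x \<epsilon>)"
    by (rule relative_to_inc)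
  moreover have "topspace X \<inter> gauge_ball X \<rho> x \<epsilon> = gauge_ball X \<rho> x \<epsilon>"
    by (auto simp: gauge_ball_def)
  ultimately have "(finite intersection_of ?B relative_to topspace X) (gauge_ball X \<rho> x \<epsilon>)"
    by simp
  then show ?thesis
    unfolding gauge_topology_def openin_subbase by (rule arbitrary_union_of_inc)
qed

text \<open>The sets containing such a finite intersection of balls around each of their points form
  a topology with all gauge balls open. The topology determined by \<open>\<P>\<close> is the
  coarsest one of that kind, hence contained in it.\<close>

lemma openin_gauge_topologyD:
  assumes gauges: "\<forall>\<rho>\<in>\<P>. gauge_on X \<rho>"
    and "openin (gauge_topology X \<P>) U" "x \<in> U"
  shows "\<exists>\<F> \<epsilon>. finite \<F> \<and> \<F> \<subseteq> \<P> \<and> 0 < \<epsilon> \<and> {y \<in> topspace X. \<forall>\<rho>\<in>\<F>. \<rho> x y < \<epsilon>} \<subseteq> U"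
proof -
  define nhd where "nhd U x \<longleftrightarrow>
      (\<exists>\<F> \<epsilon>. finite \<F> \<and> \<F> \<subseteq> \<P> \<and> 0 < \<epsilon> \<and> {y \<in> topspace X. \<forall>\<rho>\<in>\<F>. \<rho> x y < \<epsilon>} \<subseteq> U)"
    for U x
  have nhd_Int: "nhd (U \<inter> V) x" if UV: "nhd U x" "nhd V x" for U V x
  proof -
    obtain \<F> \<epsilon> where F: "finite \<F>" "\<F> \<subseteq> \<P>" "0 < \<epsilon>" "{y \<in> topspace X. \<forall>\<rho>\<in>\<F>. \<rho> x y < \<epsilon>} \<subseteq> U"
      using UV(1) unfolding nhd_def by (elim exE conjE)
    obtain \<H> \<delta> where H: "finite \<H>" "\<H> \<subseteq> \<P>" "0 < \<delta>" "{y \<in> topspace X. \<forall>\<rho>\<in>\<H>. \<rho> x y < \<delta>} \<subseteq> V"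
      using UV(2) unfolding nhd_def by (elim exE conjE)
    have "{y \<in> topspace X. \<forall>\<rho>\<in>\<F> \<union> \<H>. \<rho> x y < min \<epsilon> \<delta>} \<subseteq> U \<inter> V"
      using F(4) H(4) by auto
    then show ?thesis
      unfolding nhd_def using F H by (intro exI[of _ "\<F> \<union> \<H>"] exI[of _ "min \<epsilon> \<delta>"]) simp
  qed
  have nhd_mono: "nhd V x" if "nhd U x" "U \<subseteq> V" for U V x
    using that unfolding nhd_def by (meson order_trans)
  let ?open = "\<lambda>U. U \<subseteq> topspace X \<and> (\<forall>x\<in>U. nhd U x)"
  have ist: "istopology ?open"
    unfolding istopology_def
  proof (intro conjI allI impI)
    fix U V
    assume "?open U" "?open V"
    then show "U \<inter> V \<subseteq> topspace X" "\<forall>x\<in>U \<inter> V. nhd (U \<inter> V) x"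
      using nhd_Int by auto
  next
    fix \<U>
    assume "\<forall>U\<in>\<U>. ?open U"
    then show "\<Union>\<U> \<subseteq> topspace X" "\<forall>x\<in>\<Union>\<U>. nhd (\<Union>\<U>) x"
      by (auto intro: nhd_mono[OF _ Union_upper])
  qed
  then have open_iff: "openin (topology ?open) = ?open"
    by (rule topology_inverse')
  have "openin (topology ?open) U"
  proof (rule minimal_topology_subbase)
    show "openin (topology (arbitrary union_of (finite intersection_of
        (\<lambda>S. \<exists>\<rho>\<in>\<P>. \<exists>x\<in>topspace X. \<exists>\<epsilon>>0. S = gauge_ball X \<rho> x \<epsilon>) relative_to topspace X))) U"
      using assms(2) unfolding gauge_topology_def .
    \<comment> \<open>With no gauge imposed the neighbourhood is all of \<open>topspace X\<close>,
      so an empty \<open>\<P>\<close> is covered too.\<close>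
    have "nhd (topspace X) x" for x
      unfolding nhd_def by (intro exI[of _ "{}"] exI[of _ 1]) simp
    then show "openin (topology ?open) (topspace X)"
      unfolding open_iff by simp
    show "openin (topology ?open) S"
      if "\<exists>\<rho>\<in>\<P>. \<exists>x\<in>topspace X. \<exists>\<epsilon>>0. S = gauge_ball X \<rho> x \<epsilon>" for S
    proof -
      obtain \<rho> z \<epsilon> where \<rho>: "\<rho> \<in> \<P>" and z: "z \<in> topspace X" and S: "S = gauge_ball X \<rho> z \<epsilon>"
        using \<open>\<exists>\<rho>\<in>\<P>. _\<close> by blast
      have "nhd S y" if y: "y \<in> S" for y
      proof -
        have "y \<in> topspace X" "\<rho> z y < \<epsilon>"
          using y S by (auto simp: gauge_ball_def)
        then have "{w \<in> topspace X. \<forall>\<rho>\<in>{\<rho>}. \<rho> y w < \<epsilon> - \<rho> z y} \<subseteq> S"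
          using gauge_on_triangle[OF gauges[rule_format, OF \<rho>] z] unfolding S gauge_ball_def by fastforce
        then show ?thesis
          unfolding nhd_def using \<rho> \<open>\<rho> z y < \<epsilon>\<close>
          by (intro exI[of _ "{\<rho>}"] exI[of _ "\<epsilon> - \<rho> z y"]) simp
      qed
      moreover have "S \<subseteq> topspace X"
        unfolding S gauge_ball_def by auto
      ultimately show ?thesis
        unfolding open_iff by simp
    qed
  qed
  then have "nhd U x"
    using assms(3) unfolding open_iff by simp
  then show ?thesis
    unfolding nhd_def .
qed

text \<open>Balls of integer radius around \<open>x\<close> form an increasing open cover, so one of
  them contains \<open>K\<close>. Radii start at 1 because openness is known for positive
  radii.\<close>

lemma compactin_subset_gauge_ball:
  assumes "gauge_on X \<rho>" "x \<in> topspace X" "compactin X K"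
  shows "\<exists>r>0. K \<subseteq> gauge_ball X \<rho> x r"
proof -
  let ?B = "\<lambda>n. gauge_ball X \<rho> x (real (Suc n))"
  have "openin X U" if "U \<in> range ?B" for U
    using that openin_gauge_ball[OF assms(1,2)] by auto
  moreover have "K \<subseteq> \<Union>(range ?B)"
  proof
    fix y
    assume "y \<in> K"
    then have "y \<in> topspace X"
      using compactin_subset_topspace[OF assms(3)] by blast
    moreover obtain n where "\<rho> x y < real n"
      using reals_Archimedean2 by blast
    ultimately have "y \<in> ?B n"
      by (simp add: gauge_ball_def)
    then show "y \<in> \<Union>(range ?B)" by blast
  qed
  ultimately obtain \<F> where "finite \<F>" "\<F> \<subseteq> range ?B" "K \<subseteq> \<Union>\<F>"
    using compactinD[OF assms(3), of "range ?B"] by metis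
  then obtain J where J: "finite J" "\<F> = ?B ` J"
    using finite_subset_image[of \<F> ?B UNIV] by auto
  then obtain m where m: "\<forall>n\<in>J. n \<le> m"
    using finite_nat_set_iff_bounded_le by blast
  have "\<Union>(?B ` J) \<subseteq> ?B m"
    using m by (fastforce simp: gauge_ball_def)
  then have "K \<subseteq> ?B m"
    using \<open>K \<subseteq> \<Union>\<F>\<close> unfolding J(2) by (rule order_trans[rotated])
  then show ?thesis
    by (intro exI[of _ "real (Suc m)"]) simp
qed


section \<open>Proper isometrizability implies the conditions on the action\<close>

context homeomorphism_action
begin

text \<open>If a translate of \<open>A\<close> meets \<open>B\<close>, it has a point within
  \<open>s\<close> of \<open>x\<close>, and by invariance its other points are within
  \<open>2 * r\<close> of that one. All such translates lie in one ball, whose closure is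
  compact.\<close>

lemma properly_isometrizable_imp_nearly_proper:
  assumes "properly_isometrizable X G"
  shows "nearly_proper X G"
  unfolding nearly_proper_def
proof (intro allI impI, elim conjE)
  fix A B
  assume A: "compactin X A" and B: "compactin X B"
  let ?U = "\<Union>{g ` A | g. g \<in> G \<and> g ` A \<inter> B \<noteq> {}}"
  obtain \<P> where P: "proper_gauge_structure X \<P>" "invariant_gauges X G \<P>"
    using assms unfolding properly_isometrizable_def by blast
  show "compactin X (X closure_of ?U)"
  proof (cases "topspace X = {} \<or> \<P> = {}")
    case True
    \<comment> \<open>Without a gauge, separation leaves at most one point, and in a finite space
      every closure is compact.\<close>
    have "finite (topspace X)"
    proof (cases "topspace X = {}")
      case False
      then have "\<forall>x\<in>topspace X. \<forall>y\<in>topspace X. x = y"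
        using True P(1)
        by (auto simp: proper_gauge_structure_def gauge_structure_def separating_gauges_def)
      then obtain x where "topspace X \<subseteq> {x}"
        using False by blast
      then show ?thesis
        by (rule finite_subset) simp
    qed simp
    then have "finite (X closure_of ?U)"
      by (rule finite_subset[OF closure_of_subset_topspace])
    then show ?thesis
      by (intro finite_imp_compactin closure_of_subset_topspace)
  next
    case False
    then obtain x \<rho> where x: "x \<in> topspace X" and \<rho>: "\<rho> \<in> \<P>"
      by (metis ex_in_conv)
    have proper: "proper_gauge_on X \<rho>"
      using P(1) \<rho> by (simp add: proper_gauge_structure_def)
    then have gauge: "gauge_on X \<rho>"
      by (simp add: proper_gauge_on_def)
    obtain r where r: "0 < r" "A \<subseteq> gauge_ball X \<rho> x r"
      using compactin_subset_gauge_ball[OF gauge x A] by blast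
    obtain s where s: "0 < s" "B \<subseteq> gauge_ball X \<rho> x s"
      using compactin_subset_gauge_ball[OF gauge x B] by blast
    have "g a \<in> gauge_ball X \<rho> x (s + 2 * r)"
      if g: "g \<in> G" and b: "b \<in> A" "g b \<in> B" and a: "a \<in> A" for g a b
    proof -
      have ab: "a \<in> topspace X" "b \<in> topspace X" "\<rho> x a < r" "\<rho> x b < r" "\<rho> x (g b) < s"
        using r(2) s(2) a b by (auto simp: gauge_ball_def)
      have "\<rho> (g b) (g a) = \<rho> b a"
        using P(2) \<rho> g ab unfolding invariant_gauges_def by simp
      also have "\<dots> \<le> \<rho> b x + \<rho> x a"
        by (rule gauge_on_triangle[OF gauge ab(2) x ab(1)])
      also have "\<rho> b x = \<rho> x b"
        by (rule gauge_on_sym[OF gauge ab(2) x])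
      finally have "\<rho> x (g a) < s + 2 * r"
        using gauge_on_triangle[OF gauge x action_in_topspace[OF g ab(2)]
            action_in_topspace[OF g ab(1)]] ab by linarith
      then show ?thesis
        using action_in_topspace[OF g ab(1)] by (simp add: gauge_ball_def)
    qed
    then have "?U \<subseteq> gauge_ball X \<rho> x (s + 2 * r)" by auto
    then have "X closure_of ?U \<subseteq> X closure_of gauge_ball X \<rho> x (s + 2 * r)"
      by (rule closure_of_mono)
    moreover have "compactin X (X closure_of gauge_ball X \<rho> x (s + 2 * r))"
      using proper x r(1) s(1) by (simp add: proper_gauge_on_def)
    ultimately show ?thesis
      by (intro closed_compactin[OF _ _ closedin_closure_of])
  qed
qed

text \<open>A basic neighbourhood of \<open>x\<close> inside \<open>U\<close> involves finitely many
  gauges and one radius. By invariance a small ball around any \<open>y\<close> keeps its diameter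
  when translated, so once it touches the closure of a small ball at \<open>x\<close> it cannot
  leave \<open>U\<close>.\<close>

lemma properly_isometrizable_imp_equiregular:
  assumes "properly_isometrizable X G"
  shows "equiregular X G"
  unfolding equiregular_def
proof (intro ballI allI impI, elim conjE)
  fix x U
  assume x: "x \<in> topspace X" and U: "openin X U" "x \<in> U"
  obtain \<P> where P: "proper_gauge_structure X \<P>" "invariant_gauges X G \<P>"
    using assms unfolding properly_isometrizable_def by blast
  have gauges: "\<forall>\<rho>\<in>\<P>. gauge_on X \<rho>"
    using P(1) by (simp add: proper_gauge_structure_def proper_gauge_on_def)
  have "openin (gauge_topology X \<P>) U"
    using P(1) U(1) by (simp add: proper_gauge_structure_def gauge_structure_def)
  from openin_gauge_topologyD[OF gauges this U(2)]
  obtain \<F> \<epsilon> where F: "finite \<F>" "\<F> \<subseteq> \<P>" and \<epsilon>: "0 < \<epsilon>"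
    and ball: "{y \<in> topspace X. \<forall>\<rho>\<in>\<F>. \<rho> x y < \<epsilon>} \<subseteq> U"
    by (elim exE conjE)
  have gauge: "gauge_on X \<rho>" if "\<rho> \<in> \<F>" for \<rho>
    using gauges F(2) that by blast
  define N where "N y d = {z \<in> topspace X. \<forall>\<rho>\<in>\<F>. \<rho> y z < d}" for y d
  have N_open: "openin X (N y d)" and N_self: "y \<in> N y d" if y: "y \<in> topspace X" and d: "0 < d" for y d
  proof -
    show "openin X (N y d)"
      unfolding N_def by (rule openin_gauge_balls[OF F(1) gauge y d])
    have "\<rho> y y < d" if "\<rho> \<in> \<F>" for \<rho>
      using gauge_on_refl[OF gauge[OF that] y] d by simp
    then show "y \<in> N y d"
      unfolding N_def using y by simp
  qed
  \<comment> \<open>The closure of \<open>?V\<close> stays within \<open>\<epsilon> / 2\<close> of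
    \<open>x\<close>, and balls of radius \<open>\<epsilon> / 8\<close> have diameter at most
    \<open>\<epsilon> / 4\<close>; together this is below \<open>\<epsilon>\<close>.\<close>
  let ?V = "N x (\<epsilon> / 4)"
  have clo: "y \<in> topspace X \<and> (\<forall>\<rho>\<in>\<F>. \<rho> x y < \<epsilon> / 2)" if y: "y \<in> X closure_of ?V" for y
  proof
    show y_top: "y \<in> topspace X"
      using y by (simp add: in_closure_of)
    obtain z where z: "z \<in> ?V" "z \<in> N y (\<epsilon> / 4)"
      using y N_open[OF y_top, of "\<epsilon> / 4"] N_self[OF y_top, of "\<epsilon> / 4"] \<epsilon>
      unfolding in_closure_of by auto
    show "\<forall>\<rho>\<in>\<F>. \<rho> x y < \<epsilon> / 2"
    proof
      fix \<rho>
      assume \<rho>: "\<rho> \<in> \<F>"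
      have z_top: "z \<in> topspace X"
        using z(1) by (simp add: N_def)
      have "\<rho> x z < \<epsilon> / 4" "\<rho> y z < \<epsilon> / 4"
        using z \<rho> by (simp_all add: N_def)
      then show "\<rho> x y < \<epsilon> / 2"
        using gauge_on_triangle[OF gauge[OF \<rho>] x z_top y_top]
          gauge_on_sym[OF gauge[OF \<rho>] z_top y_top] by linarith
    qed
  qed
  have "g ` N y (\<epsilon> / 8) \<subseteq> U"
    if y: "y \<in> topspace X" and g: "g \<in> G"
      and meet: "g ` N y (\<epsilon> / 8) \<inter> X closure_of ?V \<noteq> {}" for y g
  proof -
    obtain w where w: "w \<in> N y (\<epsilon> / 8)" "g w \<in> X closure_of ?V"
      using meet by blast
    have w_top: "w \<in> topspace X"
      using w(1) by (simp add: N_def)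
    have "g z \<in> {y \<in> topspace X. \<forall>\<rho>\<in>\<F>. \<rho> x y < \<epsilon>}" if z: "z \<in> N y (\<epsilon> / 8)" for z
    proof (intro CollectI conjI ballI)
      have z_top: "z \<in> topspace X"
        using z by (simp add: N_def)
      show "g z \<in> topspace X"
        by (rule action_in_topspace[OF g z_top])
      fix \<rho>
      assume \<rho>: "\<rho> \<in> \<F>"
      have "\<rho> (g w) (g z) = \<rho> w z"
        using P(2) F(2) \<rho> g w_top z_top unfolding invariant_gauges_def by blast
      moreover have "\<rho> w z \<le> \<rho> w y + \<rho> y z"
        by (rule gauge_on_triangle[OF gauge[OF \<rho>] w_top y z_top])
      moreover have "\<rho> w y = \<rho> y w"
        by (rule gauge_on_sym[OF gauge[OF \<rho>] w_top y])
      moreover have "\<rho> y w < \<epsilon> / 8" "\<rho> y z < \<epsilon> / 8"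
        using w(1) z \<rho> by (simp_all add: N_def)
      moreover have "\<rho> x (g w) < \<epsilon> / 2"
        using clo[OF w(2)] \<rho> by blast
      moreover have "\<rho> x (g z) \<le> \<rho> x (g w) + \<rho> (g w) (g z)"
        by (rule gauge_on_triangle[OF gauge[OF \<rho>] x action_in_topspace[OF g w_top]
              action_in_topspace[OF g z_top]])
      ultimately show "\<rho> x (g z) < \<epsilon>"
        using \<epsilon> by linarith
    qed
    with ball show ?thesis by blast
  qed
  then have "\<exists>N. openin X N \<and> y \<in> N \<and>
      (\<forall>g\<in>G. g ` N \<inter> X closure_of ?V \<noteq> {} \<longrightarrow> g ` N \<subseteq> U)" if "y \<in> topspace X" for y
    using N_open N_self \<epsilon> that by (intro exI[of _ "N y (\<epsilon> / 8)"]) simp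
  moreover have "X closure_of ?V \<subseteq> U"
  proof
    fix y
    assume "y \<in> X closure_of ?V"
    from clo[OF this] have "y \<in> {y \<in> topspace X. \<forall>\<rho>\<in>\<F>. \<rho> x y < \<epsilon>}"
      using \<epsilon> by fastforce
    with ball show "y \<in> U" by blast
  qed
  moreover have "openin X ?V" "x \<in> ?V"
    using N_open[OF x] N_self[OF x] \<epsilon> by simp_all
  ultimately show "\<exists>V. openin X V \<and> x \<in> V \<and> X closure_of V \<subseteq> U \<and>
      (\<forall>y\<in>topspace X. \<exists>N. openin X N \<and> y \<in> N \<and>
         (\<forall>g\<in>G. g ` N \<inter> X closure_of V \<noteq> {} \<longrightarrow> g ` N \<subseteq> U))"
    by (intro exI[of _ ?V]) simp
qed

end

section \<open>Construction of a proper invariant gauge structure\<close>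

context homeomorphism_action
begin

text \<open>Images need not be closed, so containment in a compact set is asked instead of
  compactness; in this form the property passes to smaller relations and to compositions.\<close>

definition compactly_bounded :: "('a \<times> 'a) set \<Rightarrow> bool" where
  "compactly_bounded E \<longleftrightarrow> (\<forall>K. compactin X K \<longrightarrow> (\<exists>C. compactin X C \<and> E `` K \<subseteq> C))"

lemma compactly_bounded_subset:
  assumes "compactly_bounded E" "D \<subseteq> E"
  shows "compactly_bounded D"
  unfolding compactly_bounded_def
proof (intro allI impI)
  fix K
  assume "compactin X K"
  then obtain C where "compactin X C" "E `` K \<subseteq> C"
    using assms(1) unfolding compactly_bounded_def by blast
  moreover have "D `` K \<subseteq> E `` K"
    using assms(2) by blast
  ultimately show "\<exists>C. compactin X C \<and> D `` K \<subseteq> C"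
    by (intro exI[of _ C]) simp
qed

lemma compactly_bounded_comp:
  assumes "compactly_bounded D" "compactly_bounded E"
  shows "compactly_bounded (D O E)"
  unfolding compactly_bounded_def
proof (intro allI impI)
  fix K
  assume "compactin X K"
  then obtain B where B: "compactin X B" "D `` K \<subseteq> B"
    using assms(1) unfolding compactly_bounded_def by blast
  obtain C where C: "compactin X C" "E `` B \<subseteq> C"
    using assms(2) B(1) unfolding compactly_bounded_def by blast
  have "(D O E) `` K \<subseteq> C"
    using B(2) C(2) by blast
  with C(1) show "\<exists>C. compactin X C \<and> (D O E) `` K \<subseteq> C" by blast
qed

lemma compactly_bounded_Un:
  assumes "compactly_bounded D" "compactly_bounded E"
  shows "compactly_bounded (D \<union> E)"
  unfolding compactly_bounded_def
proof (intro allI impI)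
  fix K
  assume K: "compactin X K"
  obtain B where B: "compactin X B" "D `` K \<subseteq> B"
    using assms(1) K unfolding compactly_bounded_def by blast
  obtain C where C: "compactin X C" "E `` K \<subseteq> C"
    using assms(2) K unfolding compactly_bounded_def by blast
  have "(D \<union> E) `` K \<subseteq> B \<union> C"
    using B(2) C(2) by blast
  with compactin_Un[OF B(1) C(1)] show "\<exists>C. compactin X C \<and> (D \<union> E) `` K \<subseteq> C"
    by (intro exI[of _ "B \<union> C"] conjI)
qed

text \<open>Refining a cover by neighbourhoods with compact hulls puts each star of \<open>E\<close>
  into a translate of a compact set. Local compactness enters only through this cover.\<close>

lemma ex_compactly_bounded_entourage:
  assumes "sigma_compact_space X" "regular_space (orbit_space X G)" "equiregular X G"
    and "locally_compact_space X"
  shows "\<exists>D. entourage D \<and> compactly_bounded D"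
proof -
  let ?S = "topspace X"
  define R where "R x U K \<longleftrightarrow> openin X U \<and> compactin X K \<and> x \<in> U \<and> U \<subseteq> K" for x U K
  have "\<exists>U K. R x U K" if "x \<in> ?S" for x
    using assms(4) that unfolding locally_compact_space_def R_def by simp
  then obtain U K where R: "\<And>x. x \<in> ?S \<Longrightarrow> R x (U x) (K x)"
    by metis
  note UK = R[unfolded R_def]
  have U: "openin X (U x) \<and> x \<in> U x" if "x \<in> ?S" for x
    using UK[OF that] by simp
  obtain E where E: "entourage E"
    and star: "\<forall>p\<in>?S. \<exists>x\<in>?S. \<exists>g\<in>G. E `` {p} \<subseteq> g ` U x"
    using ex_refining_entourage[OF assms(1-3) U] by blast
  have bounded: "\<exists>C. compactin X C \<and> E `` {p} \<subseteq> C" if p: "p \<in> ?S" for p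
  proof -
    obtain x g where xg: "x \<in> ?S" "g \<in> G" "E `` {p} \<subseteq> g ` U x"
      using star p by blast
    have "g ` U x \<subseteq> g ` K x"
      using UK[OF xg(1)] by (simp add: image_mono)
    with xg(3) have "E `` {p} \<subseteq> g ` K x"
      by (rule order_trans)
    moreover have "compactin X (g ` K x)"
      using UK[OF xg(1)] by (simp add: compactin_action[OF xg(2)])
    ultimately show ?thesis
      by (intro exI[of _ "g ` K x"] conjI)
  qed
  \<comment> \<open>A bound at single points is not yet one over compact sets. One factor
    \<open>D\<close> leads from a finite set of centres to the points of \<open>A\<close>, the other
    to their images.\<close>
  obtain D where D: "entourage D" "D O D \<subseteq> E"
    using ex_half_entourage[OF assms(1-3) E] by blast
  have "\<exists>C. compactin X C \<and> D `` A \<subseteq> C" if A: "compactin X A" for A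
  proof -
    have A_top: "A \<subseteq> ?S"
      using compactin_subset_topspace[OF A] .
    have "\<exists>N. openin X N \<and> y \<in> N \<and> N \<times> N \<subseteq> D" if "y \<in> ?S" for y
      using D(1) that unfolding entourage_def by simp
    then obtain N where N: "\<And>y. y \<in> ?S \<Longrightarrow> openin X (N y) \<and> y \<in> N y \<and> N y \<times> N y \<subseteq> D"
      by metis
    have "openin X V" if "V \<in> N ` A" for V
      using that N A_top by auto
    moreover have "A \<subseteq> \<Union>(N ` A)"
      using N A_top by auto
    ultimately obtain \<F> where F: "finite \<F>" "\<F> \<subseteq> N ` A" "A \<subseteq> \<Union>\<F>"
      using compactinD[OF A, of "N ` A"] by metis
    then obtain J where J: "finite J" "J \<subseteq> A" "\<F> = N ` J"
      using finite_subset_image[OF F(1,2)] by auto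
    have J_top: "y \<in> ?S" if "y \<in> J" for y
      using that J(2) A_top by blast
    obtain C where C: "\<And>y. y \<in> ?S \<Longrightarrow> compactin X (C y) \<and> E `` {y} \<subseteq> C y"
      using bounded by metis
    have "compactin X (\<Union>(C ` J))"
      using J(1) J_top C by (intro compactin_Union) auto
    moreover have "D `` A \<subseteq> \<Union>(C ` J)"
    proof
      fix b
      assume "b \<in> D `` A"
      then obtain a where a: "a \<in> A" "(a, b) \<in> D" by blast
      then obtain y where y: "y \<in> J" "a \<in> N y"
        using F(3) J(3) by blast
      then have "(y, a) \<in> D"
        using N[OF J_top[OF y(1)]] by blast
      then have "(y, b) \<in> E"
        using a(2) D(2) by blast
      then show "b \<in> \<Union>(C ` J)"
        using C[OF J_top[OF y(1)]] y(1) by blast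
    qed
    ultimately show ?thesis
      by (intro exI[of _ "\<Union>(C ` J)"] conjI)
  qed
  with D(1) show ?thesis
    unfolding compactly_bounded_def by (intro exI[of _ D]) simp
qed

section \<open>Relations generated by the translates of a compact set\<close>

definition orbit_square :: "'a set \<Rightarrow> ('a \<times> 'a) set" where
  "orbit_square K = (\<Union>g\<in>G. g ` K \<times> g ` K)"

lemma orbit_square_subset: "K \<subseteq> topspace X \<Longrightarrow> orbit_square K \<subseteq> topspace X \<times> topspace X"
  unfolding orbit_square_def by (auto simp: action_in_topspace subset_iff)

lemma sym_orbit_square: "sym (orbit_square K)"
  unfolding orbit_square_def by (rule symI) auto

lemma orbit_square_action:
  assumes "K \<subseteq> topspace X" "g \<in> G" "(x, y) \<in> orbit_square K"
  shows "(g x, g y) \<in> orbit_square K"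
proof -
  obtain h u v where h: "h \<in> G" "u \<in> K" "v \<in> K" "x = h u" "y = h v"
    using assms(3) unfolding orbit_square_def by auto
  obtain k where k: "k \<in> G" "\<forall>x\<in>topspace X. k x = g (h x)"
    using ex_composition[OF assms(2) h(1)] by blast
  then have "g x = k u" "g y = k v"
    using h assms(1) by auto
  then show ?thesis
    using k(1) h(2,3) unfolding orbit_square_def by auto
qed

lemma subset_orbit_square:
  assumes "K \<subseteq> topspace X"
  shows "K \<times> K \<subseteq> orbit_square K"
proof -
  obtain e where e: "e \<in> G" "\<forall>x\<in>topspace X. e x = x"
    using ex_identity by blast
  then have "e ` K = K"
    using assms by force
  then show ?thesis
    using e(1) unfolding orbit_square_def by blast
qed

text \<open>Only translates of \<open>K\<close> that meet \<open>B\<close> contribute to the image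
  of \<open>B\<close>, which is exactly the union that near properness controls.\<close>

lemma compactly_bounded_orbit_square:
  assumes "nearly_proper X G" "compactin X K"
  shows "compactly_bounded (orbit_square K)"
  unfolding compactly_bounded_def
proof (intro allI impI)
  fix B
  assume B: "compactin X B"
  let ?U = "\<Union>{g ` K | g. g \<in> G \<and> g ` K \<inter> B \<noteq> {}}"
  have K: "K \<subseteq> topspace X"
    using compactin_subset_topspace[OF assms(2)] .
  have "?U \<subseteq> topspace X"
    using K by (auto simp: action_in_topspace subset_iff)
  then have "?U \<subseteq> X closure_of ?U"
    by (rule closure_of_subset)
  moreover have "orbit_square K `` B \<subseteq> ?U"
    unfolding orbit_square_def by auto
  ultimately have "orbit_square K `` B \<subseteq> X closure_of ?U"
    by (rule order_trans[rotated])
  moreover have "compactin X (X closure_of ?U)"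
    using assms B unfolding nearly_proper_def by simp
  ultimately show "\<exists>C. compactin X C \<and> orbit_square K `` B \<subseteq> C"
    by (intro exI[of _ "X closure_of ?U"] conjI)
qed

section \<open>Two-sided sequences of entourages\<close>

lemma sigma_compact_increasing_cover:
  assumes "sigma_compact_space X"
  shows "\<exists>K :: nat \<Rightarrow> 'a set. (\<forall>n. compactin X (K n)) \<and> incseq K \<and> \<Union>(range K) = topspace X"
proof -
  obtain \<K> where K: "countable \<K>" "\<forall>K\<in>\<K>. compactin X K" "\<Union>\<K> = topspace X"
    using assms unfolding sigma_compact_space_def by (elim exE conjE)
  \<comment> \<open>Inserting \<open>{}\<close> keeps the enumerated family nonempty.\<close>
  define e where "e = from_nat_into (insert {} \<K>)"
  have e: "range e = insert {} \<K>"
    unfolding e_def using K(1) by (intro range_from_nat_into) auto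
  then have "compactin X (e n)" for n
    using K(2) by (metis compactin_empty insertE rangeI)
  then have "compactin X (\<Union>(e ` {..n}))" for n
    by (intro compactin_Union) auto
  moreover have "incseq (\<lambda>n. \<Union>(e ` {..n}))"
    by (intro monoI Union_mono image_mono) simp
  moreover have "(\<Union>n. \<Union>(e ` {..n})) = \<Union>(range e)"
    by auto
  then have "(\<Union>n. \<Union>(e ` {..n})) = topspace X"
    using e K(3) by simp
  ultimately show ?thesis
    by (intro exI[of _ "\<lambda>n. \<Union>(e ` {..n})"]) simp
qed

text \<open>Each step takes the threefold composition and adjoins the orbit square of the next
  compact set. Both operations preserve compact boundedness, and the squares exhaust all
  pairs.\<close>

lemma ex_expanding_entourages:
  assumes "sigma_compact_space X" "nearly_proper X G" "entourage D" "compactly_bounded D"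
  shows "\<exists>H :: nat \<Rightarrow> ('a \<times> 'a) set. H 0 = D \<and> (\<forall>n. entourage (H n) \<and> compactly_bounded (H n)) \<and>
           (\<forall>n. H n O H n O H n \<subseteq> H (Suc n)) \<and> \<Union>(range H) = topspace X \<times> topspace X"
proof -
  obtain K :: "nat \<Rightarrow> 'a set" where K: "\<forall>n. compactin X (K n)" "incseq K" "\<Union>(range K) = topspace X"
    using sigma_compact_increasing_cover[OF assms(1)] by (elim exE conjE)
  have K_top: "K n \<subseteq> topspace X" for n
    using K(1) compactin_subset_topspace by auto
  \<comment> \<open>The clause at \<open>n = 0\<close> pins the starting value in the dependent
    choice.\<close>
  define P where "P n E \<longleftrightarrow> entourage E \<and> compactly_bounded E \<and> (n = 0 \<longrightarrow> E = D)" for n :: nat and E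
  define Q where "Q n E F \<longleftrightarrow> E O E O E \<subseteq> F \<and> orbit_square (K n) \<subseteq> F" for n and E F :: "('a \<times> 'a) set"
  have "\<exists>F. P (Suc n) F \<and> Q n E F" if E: "P n E" for n E
  proof -
    let ?F = "E O E O E \<union> orbit_square (K n)"
    have E: "entourage E" "compactly_bounded E"
      using E by (simp_all add: P_def)
    note E3 = entourage_comp3[OF E(1)]
    have "entourage ?F"
    \<comment> \<open>An orbit square need not contain the diagonal; the neighbourhood condition is
      inherited from \<open>E O E O E\<close>.\<close>
    proof (rule entourage_mono[OF E3])
      show "?F \<subseteq> topspace X \<times> topspace X"
        using entourage_subset[OF E3] orbit_square_subset[OF K_top] by (rule Un_least)
      show "sym ?F"
        using E3 sym_orbit_square by (intro sym_Un) (simp_all add: entourage_def)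
      show "(g x, g y) \<in> ?F" if "g \<in> G" "(x, y) \<in> ?F" for g x y
        using that(2) entourage_action[OF E3 that(1)] orbit_square_action[OF K_top that(1)]
        by (elim UnE) simp_all
    qed simp
    moreover have "compactly_bounded ?F"
      by (intro compactly_bounded_Un compactly_bounded_comp E(2)
          compactly_bounded_orbit_square[OF assms(2)] K(1)[rule_format])
    ultimately have "P (Suc n) ?F" "Q n E ?F"
      by (simp_all add: P_def Q_def)
    then show ?thesis
      by (intro exI[of _ ?F] conjI)
  qed
  moreover have "P 0 D"
    using assms(3,4) by (simp add: P_def)
  ultimately obtain H where H: "\<forall>n. P n (H n) \<and> Q n (H n) (H (Suc n))"
    using dependent_nat_choice[of P Q] by blast
  have ent: "entourage (H n)" "compactly_bounded (H n)" for n
    using H by (simp_all add: P_def)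
  have "\<Union>(range H) = topspace X \<times> topspace X"
  proof
    show "\<Union>(range H) \<subseteq> topspace X \<times> topspace X"
      by (intro UN_least entourage_subset ent)
    show "topspace X \<times> topspace X \<subseteq> \<Union>(range H)"
    proof (clarify, unfold K(3)[symmetric], clarify)
      fix x y m n
      assume "x \<in> K m" "y \<in> K n"
      then have "x \<in> K (max m n)" "y \<in> K (max m n)"
        using K(2) by (meson incseqD max.cobounded1 max.cobounded2 subsetD)+
      then have "(x, y) \<in> orbit_square (K (max m n))"
        using subset_orbit_square[OF K_top] by blast
      then have "(x, y) \<in> H (Suc (max m n))"
        using H unfolding Q_def by blast
      then show "(x, y) \<in> \<Union>(range H)" by blast
    qed
  qed
  then show ?thesis
    using H ent by (intro exI[of _ H]) (simp add: P_def Q_def)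
qed

lemma ex_shrinking_entourages:
  assumes "sigma_compact_space X" "regular_space (orbit_space X G)" "equiregular X G" "entourage D"
  shows "\<exists>N :: nat \<Rightarrow> ('a \<times> 'a) set. N 0 = D \<and> (\<forall>n. entourage (N n)) \<and>
           (\<forall>n. N (Suc n) O N (Suc n) O N (Suc n) \<subseteq> N n)"
proof -
  define P where "P n E \<longleftrightarrow> entourage E \<and> (n = 0 \<longrightarrow> E = D)" for n :: nat and E
  define Q where "Q n E F \<longleftrightarrow> F O F O F \<subseteq> E" for n :: nat and E F :: "('a \<times> 'a) set"
  have "\<exists>F. P (Suc n) F \<and> Q n E F" if "P n E" for n E
    using ex_third_entourage[OF assms(1-3), of E] that unfolding P_def Q_def by simp
  moreover have "P 0 D"
    using assms(4) by (simp add: P_def)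
  ultimately obtain N where "\<forall>n. P n (N n) \<and> Q n (N n) (N (Suc n))"
    using dependent_nat_choice[of P Q] by blast
  then show ?thesis
    unfolding P_def Q_def by (intro exI[of _ N]) simp
qed

text \<open>A shrinking and an expanding sequence are spliced at \<open>D \<inter> B\<close>:
  \<open>D\<close> confines the unit ball at \<open>x\<close> to \<open>U\<close>, while
  \<open>B\<close> makes the expansion compactly bounded and hence the gauge proper.\<close>

lemma ex_proper_invariant_gauge:
  assumes "sigma_compact_space X" "regular_space (orbit_space X G)" "equiregular X G"
    and "locally_compact_space X" "Hausdorff_space X" "nearly_proper X G"
    and "openin X U" "x \<in> U"
  shows "\<exists>\<rho>. proper_gauge_on X \<rho> \<and> invariant_gauges X G {\<rho>} \<and> gauge_ball X \<rho> x 1 \<subseteq> U"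
proof -
  have x: "x \<in> topspace X"
    using openin_subset[OF assms(7)] assms(8) by blast
  obtain V D where D: "x \<in> V" "entourage D" "\<forall>v\<in>V. D `` {v} \<subseteq> U"
    using ex_star_entourage[OF assms(3,7,8)] by blast
  obtain B where B: "entourage B" "compactly_bounded B"
    using ex_compactly_bounded_entourage[OF assms(1-4)] by blast
  have E: "entourage (D \<inter> B)" "compactly_bounded (D \<inter> B)"
    by (rule entourage_Int[OF D(2) B(1)], rule compactly_bounded_subset[OF B(2)], simp)
  obtain H :: "nat \<Rightarrow> ('a \<times> 'a) set" where H: "H 0 = D \<inter> B"
      "\<forall>n. entourage (H n) \<and> compactly_bounded (H n)" "\<forall>n. H n O H n O H n \<subseteq> H (Suc n)"
      "\<Union>(range H) = topspace X \<times> topspace X"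
    using ex_expanding_entourages[OF assms(1,6) E] by (elim exE conjE)
  obtain N :: "nat \<Rightarrow> ('a \<times> 'a) set" where N: "N 0 = D \<inter> B" "\<forall>n. entourage (N n)"
      "\<forall>n. N (Suc n) O N (Suc n) O N (Suc n) \<subseteq> N n"
    using ex_shrinking_entourages[OF assms(1-3) E(1)] by (elim exE conjE)
  \<comment> \<open>Nonnegative indices expand and negative ones shrink. The unit ball has radius
    \<open>2 powi 0\<close>, so it is governed by \<open>F 0\<close>, that is by
    \<open>D \<inter> B\<close>.\<close>
  define F where "F k = (if 0 \<le> k then H (nat k) else N (nat (- k)))" for k :: int
  have F_ent: "entourage (F k)" for k
    using H(2) N(2) by (simp add: F_def)
  have F_comp: "F k O F k O F k \<subseteq> F (k + 1)" for k
  proof (cases "0 \<le> k")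
    case True
    then have "nat (k + 1) = Suc (nat k)" by simp
    with True H(3) show ?thesis by (simp add: F_def)
  next
    case False
    then have "nat (- k) = Suc (nat (- (k + 1)))" by simp
    then have "F k O F k O F k \<subseteq> N (nat (- (k + 1)))"
      using False N(3) by (simp add: F_def)
    moreover have "N (nat (- (k + 1))) = F (k + 1)"
    \<comment> \<open>At \<open>k = -1\<close> the two sequences meet; they agree there because both
      start at \<open>D \<inter> B\<close>.\<close>
    proof (cases "k + 1 = 0")
      case True
      then show ?thesis using H(1) N(1) by (simp add: F_def)
    next
      case False
      then show ?thesis using \<open>\<not> 0 \<le> k\<close> by (simp add: F_def)
    qed
    ultimately show ?thesis by simp
  qed
  have F_nat: "F (int n) = H n" for n
    by (simp add: F_def)
  have F_cover: "\<Union>(range F) = topspace X \<times> topspace X"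
  proof
    show "\<Union>(range F) \<subseteq> topspace X \<times> topspace X"
      by (intro UN_least entourage_subset F_ent)
    show "topspace X \<times> topspace X \<subseteq> \<Union>(range F)"
      unfolding H(4)[symmetric] F_nat[symmetric] by blast
  qed
  obtain \<rho> where gauge: "gauge_on X \<rho>" and inv: "invariant_gauges X G {\<rho>}"
    and ball: "\<forall>k. \<forall>x\<in>topspace X. gauge_ball X \<rho> x (2 powi k) \<subseteq> F k `` {x}"
    using ex_invariant_gauge[OF F_ent F_comp F_cover] by (elim exE conjE)
  have "compactin X (X closure_of gauge_ball X \<rho> y \<epsilon>)" if y: "y \<in> topspace X" for y \<epsilon>
  proof -
    obtain n :: nat where "\<epsilon> < 2 ^ n"
      using real_arch_pow[of 2 \<epsilon>] by auto
    then have "gauge_ball X \<rho> y \<epsilon> \<subseteq> gauge_ball X \<rho> y (2 powi int n)"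
      by (auto simp: gauge_ball_def)
    also have "\<dots> \<subseteq> H n `` {y}"
      using ball[rule_format, OF y, of "int n"] by (simp only: F_nat)
    finally have sub: "gauge_ball X \<rho> y \<epsilon> \<subseteq> H n `` {y}" .
    have "compactin X {y}"
      using y by simp
    then obtain C where C: "compactin X C" "H n `` {y} \<subseteq> C"
      using H(2) unfolding compactly_bounded_def by blast
    \<comment> \<open>Compact sets are closed in a Hausdorff space, so the closure of the ball
      cannot leave \<open>C\<close>.\<close>
    have "X closure_of gauge_ball X \<rho> y \<epsilon> \<subseteq> C"
      using order_trans[OF sub C(2)] compactin_imp_closedin[OF assms(5) C(1)]
      by (rule closure_of_minimal)
    then show ?thesis
      by (rule closed_compactin[OF C(1) _ closedin_closure_of])
  qed
  with gauge have "proper_gauge_on X \<rho>"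
    by (simp add: proper_gauge_on_def)
  moreover have "gauge_ball X \<rho> x 1 \<subseteq> U"
  proof -
    have "gauge_ball X \<rho> x 1 \<subseteq> F 0 `` {x}"
      using ball[rule_format, OF x, of 0] by simp
    also have "\<dots> \<subseteq> D `` {x}"
      using H(1) by (auto simp: F_def)
    also have "\<dots> \<subseteq> U"
      using D(1,3) by blast
    finally show ?thesis .
  qed
  ultimately show ?thesis
    using inv by (intro exI[of _ \<rho>] conjI)
qed

text \<open>The structure consists of all invariant proper gauges. Their unit balls fit into any
  prescribed neighbourhood of their centre, which yields both the topology and, by the Hausdorff
  property, separation.\<close>

lemma properly_isometrizableI:
  assumes "sigma_compact_space X" "regular_space (orbit_space X G)" "equiregular X G"
    and "locally_compact_space X" "Hausdorff_space X" "nearly_proper X G"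
  shows "properly_isometrizable X G"
proof -
  let ?P = "{\<rho>. proper_gauge_on X \<rho> \<and> invariant_gauges X G {\<rho>}}"
  have gauges: "\<forall>\<rho>\<in>?P. gauge_on X \<rho>"
    by (simp add: proper_gauge_on_def)
  note ex_gauge = ex_proper_invariant_gauge[OF assms]
  have "separating_gauges X ?P"
    unfolding separating_gauges_def
  proof (intro ballI impI)
    fix x y
    assume xy: "x \<in> topspace X" "y \<in> topspace X" "x \<noteq> y"
    then obtain U V where U: "openin X U" "x \<in> U" "y \<in> V" "disjnt U V"
      using assms(5) unfolding Hausdorff_space_def by blast
    from ex_gauge[OF U(1,2)] obtain \<rho> where \<rho>: "\<rho> \<in> ?P" "gauge_ball X \<rho> x 1 \<subseteq> U"
      by auto
    have "y \<notin> gauge_ball X \<rho> x 1"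
      using U(3,4) \<rho>(2) by (auto simp: disjnt_def)
    then have "0 < \<rho> x y"
      using xy(2) by (simp add: gauge_ball_def)
    with \<rho>(1) show "\<exists>\<rho>\<in>?P. 0 < \<rho> x y" by blast
  qed
  moreover have "gauge_topology X ?P = X"
    unfolding topology_eq
  proof (intro allI iffI)
    fix U
    assume "openin (gauge_topology X ?P) U"
    then show "openin X U"
      by (rule openin_gauge_topology_imp_openin[OF gauges])
  next
    fix U
    assume U: "openin X U"
    have "\<exists>T. openin (gauge_topology X ?P) T \<and> x \<in> T \<and> T \<subseteq> U" if x: "x \<in> U" for x
    proof -
      have x_top: "x \<in> topspace X"
        using openin_subset[OF U] x by blast
      from ex_gauge[OF U x] obtain \<rho> where \<rho>: "\<rho> \<in> ?P" "gauge_ball X \<rho> x 1 \<subseteq> U"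
        by auto
      have "openin (gauge_topology X ?P) (gauge_ball X \<rho> x 1)"
        by (rule openin_gauge_topology_gauge_ball[OF \<rho>(1) x_top]) simp
      moreover have "x \<in> gauge_ball X \<rho> x 1"
        using gauge_on_refl[OF bspec[OF gauges \<rho>(1)] x_top] x_top by (simp add: gauge_ball_def)
      ultimately show ?thesis
        using \<rho>(2) by (intro exI[of _ "gauge_ball X \<rho> x 1"] conjI)
    qed
    then show "openin (gauge_topology X ?P) U"
      using openin_subopen[of "gauge_topology X ?P" U] by simp
  qed
  ultimately have "proper_gauge_structure X ?P"
    using gauges by (simp add: proper_gauge_structure_def gauge_structure_def)
  moreover have "invariant_gauges X G ?P"
    by (auto simp: invariant_gauges_def)
  ultimately show ?thesis
    unfolding properly_isometrizable_def by blast
qed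

end

theorem mainTheorem3:
  fixes X :: "'a topology" and G :: "('a \<Rightarrow> 'a) set"
  assumes "locally_compact_space X"
    and "sigma_compact_space X"
    and "Hausdorff_space X"
    and "homeomorphism_group X G"
    and "regular_space (orbit_space X G)"
  shows "properly_isometrizable X G \<longleftrightarrow> equiregular X G \<and> nearly_proper X G"
proof -
  interpret homeomorphism_action X G
    by unfold_locales (rule assms(4))
  show ?thesis
  proof (intro iffI conjI; (elim conjE)?)
    show "properly_isometrizable X G" if "equiregular X G" "nearly_proper X G"
      by (rule properly_isometrizableI[OF assms(2,5) that(1) assms(1,3) that(2)])
  qed (rule properly_isometrizable_imp_equiregular properly_isometrizable_imp_nearly_proper;
      assumption)+
qed

end
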